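(* Let $f\in C(\mathbb{S}^1)$ be non-constant. Then there exists a homeomorphism $\overline\tau\in\mathrm{Homeo}(\mathbb{S}^1)$ such that \[ \overline{\dim}_{\mathrm{B}}\, \Gamma(f\circ\overline\tau) = 2-\frac{1}{\overline{\dim}_{\mathrm{B}}\,\mathcal{T}(f)} = 2-\frac{1}{I(f)}. \] In particular, for all $\tau\in\mathrm{Homeo}(\mathbb{S}^1)$, \[ \frac{1}{2-\overline{\dim}_{\mathrm{B}}\,\Gamma(f\circ\tau)} \;\leq\; \overline{\dim}_{\mathrm{B}}\,\mathcal{T}(f) \;=\; \max_{\kappa\in\mathrm{Homeo}(\mathbb{S}^1)} \frac{1}{2-\overline{\dim}_{\mathrm{B}}\,\Gamma(f\circ\kappa)}. \]
   Context: $\mathbb{S}^1=[0,1]/_{0\sim 1}$ is the circle, $C(\mathbb{S}^1)$ is the set of continuous real-valued functions on $\mathbb{S}^1$, and $\mathrm{Homeo}(\mathbb{S}^1)$ is the set of homeomorphisms of $\mathbb{S}^1$ onto itself. A function on $\mathbb{S}^1$ is also regarded as a function $f$ on $[0,1]$ with $f(0)=f(1)$. Excursion functions and trees. An excursion function is a continuous $f:[0,1]\to[0,\infty)$ with $f(0)=f(1)=0$. For an excursion function $f$ and $0\le x\le y\le 1$ set $d_f(x,y)=d_f(y,x)=f(x)+f(y)-2\min_{z\in[x,y]}f(z)$. This is a pseudometric on $[0,1]$; identifying points at $d_f$-distance $0$ gives the metric space $\mathcal{T}(f)=([0,1]/_\sim,d_f)$, the real tree of $f$. For a general $f\in C(\mathbb{S}^1)$,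 let $a$ be a point where $f$ attains its minimum and let $\widetilde f(x)=f(x+a)-f(a)$, which is an excursion function; set $\mathcal{T}(f)=\mathcal{T}(\widetilde f)$. Circle maps are identified with excursion functions in this way (so $I(f)$ is also understood via $\widetilde f$). Variation index. For $p\ge 1$ and a real function $f$ on $[0,1]$, $V^p(f)=\sup\sum_{i=1}^{n-1}|f(x_i)-f(x_{i+1})|^p$, the supremum being over all finite partitions $x_1<x_2<\dots<x_n$ of points in $[0,1]$. The variation index is $I(f)=\sup\{p\ge1 : V^p(f)=\infty\}$, with the convention that the supremum of the empty set is $1$. Graph: $\Gamma(f)=\{(x,f(x)) : x\in[0,1]\}\subset\mathbb{R}^2$ with the Euclidean metric. Upper box dimension: for a totally bounded metric space $X$, $\overline{\dim}_{\mathrm{B}} X=\limsup_{r\to0}\frac{\log N_r(X)}{-\log r}$, where $N_r(X)$ is the minimal number of sets of diameter at most $r$ needed to cover $X$. Conventions: $1/\infty=0$ and $1/0=\infty$. *)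

theory Defs
  imports "HOL-Analysis.Analysis"
begin

section \<open>The circle\<close>

text \<open>
  The circle \<open>[0,1]/0~1\<close> is modelled as the unit circle of the complex plane; the class of
  \<open>t \<in> [0,1]\<close> is the point \<open>circle_pt t\<close>, so that adding \<open>a\<close> modulo 1 becomes multiplication by
  \<open>circle_pt a\<close>. The two lemmas below say that \<open>circle_pt\<close> is a quotient map identifying
  exactly 0 and 1.
\<close>

definition circle :: "complex set" where
  "circle = sphere 0 1"

definition circle_pt :: "real \<Rightarrow> complex" where
  "circle_pt t = cis (2 * pi * t)"

lemma quotient_map_circle_pt:
  "quotient_map (top_of_set {0..1}) (top_of_set circle) circle_pt"
proof (rule continuous_imp_quotient_map)
  have "continuous_on {0..1} circle_pt"
    unfolding circle_pt_def by (intro continuous_intros)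
  moreover have im: "circle_pt ` {0..1} = circle"
  proof
    show "circle_pt ` {0..1} \<subseteq> circle"
      by (auto simp: circle_pt_def circle_def)
    show "circle \<subseteq> circle_pt ` {0..1}"
    proof
      fix z assume "z \<in> circle"
      then have "norm z = 1" by (simp add: circle_def)
      then obtain t where t: "0 \<le> t" "t < 2 * pi" "z = Complex (cos t) (sin t)"
        using complex_unimodular_polar by metis
      then have "z = circle_pt (t / (2 * pi))" "t / (2 * pi) \<in> {0..1}"
        by (auto simp: circle_pt_def cis.code field_simps)
      then show "z \<in> circle_pt ` {0..1}" by blast
    qed
  qed
  ultimately show "continuous_map (top_of_set {0..1}) (top_of_set circle) circle_pt"
    by (auto simp: continuous_map_in_subtopology)
  show "compact_space (top_of_set {0..1::real})"
    by (simp add: compact_space_subtopology compactin_euclidean_iff)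
  show "Hausdorff_space (top_of_set circle)"
    by (simp add: Hausdorff_space_subtopology Hausdorff_space_euclidean)
  show "circle_pt ` topspace (top_of_set {0..1}) = topspace (top_of_set circle)"
    using im by simp
qed

lemma circle_pt_eq_iff:
  assumes "s \<in> {0..1}" "t \<in> {0..1}"
  shows "circle_pt s = circle_pt t \<longleftrightarrow> s = t \<or> s = 0 \<and> t = 1 \<or> s = 1 \<and> t = 0"
proof
  assume "circle_pt s = circle_pt t"
  then have "sin (2 * pi * s) = sin (2 * pi * t) \<and> cos (2 * pi * s) = cos (2 * pi * t)"
    by (simp add: circle_pt_def complex_eq_iff)
  then obtain n :: int where "2 * pi * s = 2 * pi * t + 2 * pi * of_int n"
    unfolding sin_cos_eq_iff by blast
  then have "2 * pi * s = 2 * pi * (t + of_int n)" by (simp add: algebra_simps)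
  then have n: "s = t + of_int n" by simp
  with assms have "n \<le> 1" "n \<ge> -1" by auto
  then consider "n = -1" | "n = 0" | "n = 1" by linarith
  then show "s = t \<or> s = 0 \<and> t = 1 \<or> s = 1 \<and> t = 0"
  proof cases
    case 1 then show ?thesis using n assms by simp
  next
    case 2 then show ?thesis using n by simp
  next
    case 3 then show ?thesis using n assms by simp
  qed
next
  have "circle_pt 0 = circle_pt 1" by (simp add: circle_pt_def)
  moreover assume "s = t \<or> s = 0 \<and> t = 1 \<or> s = 1 \<and> t = 0"
  ultimately show "circle_pt s = circle_pt t" by (elim disjE conjE) simp_all
qed

definition circle_homeos :: "(complex \<Rightarrow> complex) set" where
  "circle_homeos = {\<tau>. \<exists>\<sigma>. homeomorphism circle circle \<tau> \<sigma>}"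

section \<open>Upper box dimension\<close>

text \<open>
  The metric space is given by its carrier \<open>X\<close> and its distance function \<open>d\<close>, and is meant to be
  totally bounded: otherwise the set under the least-number operator may be empty.
  The condition on \<open>U\<close> says that its diameter is at most \<open>r\<close>.
\<close>

definition covering_number :: "'a set \<Rightarrow> ('a \<Rightarrow> 'a \<Rightarrow> real) \<Rightarrow> real \<Rightarrow> nat" where
  "covering_number X d r =
     (LEAST n. \<exists>\<U>. finite \<U> \<and> card \<U> = n \<and> X \<subseteq> \<Union>\<U> \<and>
        (\<forall>U\<in>\<U>. U \<subseteq> X \<and> (\<forall>x\<in>U. \<forall>y\<in>U. d x y \<le> r)))"

text \<open>
  Dimensions are extended reals. Division there satisfies \<open>1 / \<infinity> = 0\<close> and \<open>1 / 0 = \<infinity>\<close>.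
\<close>

definition upper_box_dim :: "'a set \<Rightarrow> ('a \<Rightarrow> 'a \<Rightarrow> real) \<Rightarrow> ereal" where
  "upper_box_dim X d =
     Limsup (at_right 0) (\<lambda>r. ereal (ln (real (covering_number X d r)) / - ln r))"

lemma "1 / (\<infinity>::ereal) = 0" "1 / (0::ereal) = \<infinity>"
  by (simp_all add: divide_ereal_def)

section \<open>Graphs\<close>

text \<open>The distance \<open>dist\<close> on pairs of reals is the Euclidean one.\<close>

definition graph :: "(complex \<Rightarrow> real) \<Rightarrow> (real \<times> real) set" where
  "graph f = (\<lambda>x. (x, f (circle_pt x))) ` {0..1}"

definition graph_dim :: "(complex \<Rightarrow> real) \<Rightarrow> ereal" where
  "graph_dim f = upper_box_dim (graph f) dist"

section \<open>Excursion functions and their trees\<close>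

definition excursion :: "(real \<Rightarrow> real) \<Rightarrow> bool" where
  "excursion g \<longleftrightarrow> continuous_on {0..1} g \<and> (\<forall>x\<in>{0..1}. 0 \<le> g x) \<and> g 0 = 0 \<and> g 1 = 0"

definition tree_pseudodist :: "(real \<Rightarrow> real) \<Rightarrow> real \<Rightarrow> real \<Rightarrow> real" where
  "tree_pseudodist g x y = g x + g y - 2 * (INF z\<in>{min x y..max x y}. g z)"

definition tree_rel :: "(real \<Rightarrow> real) \<Rightarrow> (real \<times> real) set" where
  "tree_rel g = {(x, y). x \<in> {0..1} \<and> y \<in> {0..1} \<and> tree_pseudodist g x y = 0}"

definition tree :: "(real \<Rightarrow> real) \<Rightarrow> real set set" where
  "tree g = {0..1} // tree_rel g"

text \<open>
  \<open>tree_pseudodist g\<close> is constant on \<open>A \<times> B\<close> for equivalence classes \<open>A\<close> and \<open>B\<close>, so the image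
  below is a singleton.
\<close>

definition tree_dist :: "(real \<Rightarrow> real) \<Rightarrow> real set \<Rightarrow> real set \<Rightarrow> real" where
  "tree_dist g A B = the_elem ((\<lambda>(x, y). tree_pseudodist g x y) ` (A \<times> B))"

context
  fixes g :: "real \<Rightarrow> real"
  assumes cont: "continuous_on {0..1} g"
begin

lemma tree_pseudodist_commute: "tree_pseudodist g x y = tree_pseudodist g y x"
  unfolding tree_pseudodist_def by (subst min.commute, subst max.commute) simp

lemma tree_pseudodist_refl: "tree_pseudodist g x x = 0"
  by (simp add: tree_pseudodist_def)

lemma tree_min_bdd:
  assumes "x \<in> {0..1}" "y \<in> {0..1}"
  shows "bdd_below (g ` {min x y..max x y})"
proof -
  have "{min x y..max x y} \<subseteq> {0..1}" using assms by auto
  then have "continuous_on {min x y..max x y} g"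
    by (rule continuous_on_subset[OF cont])
  then have "compact (g ` {min x y..max x y})"
    by (rule compact_continuous_image) (rule compact_Icc)
  then show ?thesis by (intro bounded_imp_bdd_below compact_imp_bounded)
qed

lemma tree_min_le:
  assumes "x \<in> {0..1}" "y \<in> {0..1}" "z \<in> {min x y..max x y}"
  shows "(INF z\<in>{min x y..max x y}. g z) \<le> g z"
  using tree_min_bdd[OF assms(1,2)] assms(3) by (rule cINF_lower)

lemma tree_pseudodist_nonneg:
  assumes "x \<in> {0..1}" "y \<in> {0..1}"
  shows "0 \<le> tree_pseudodist g x y"
proof -
  define m where "m = (INF z\<in>{min x y..max x y}. g z)"
  have "m \<le> g x" "m \<le> g y"
    unfolding m_def by (rule tree_min_le; use assms in simp)+
  moreover have "tree_pseudodist g x y = g x + g y - 2 * m"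
    unfolding tree_pseudodist_def m_def ..
  ultimately show ?thesis by linarith
qed

lemma tree_pseudodist_triangle:
  assumes "x \<in> {0..1}" "y \<in> {0..1}" "z \<in> {0..1}"
  shows "tree_pseudodist g x z \<le> tree_pseudodist g x y + tree_pseudodist g y z"
proof -
  define m where "m x y = (INF z\<in>{min x y..max x y}. g z)" for x y
  have "min (m x y) (m y z) \<le> m x z"
    unfolding m_def[of x z]
  proof (rule cINF_greatest)
    fix w assume "w \<in> {min x z..max x z}"
    then have "w \<in> {min x y..max x y} \<or> w \<in> {min y z..max y z}" by auto
    then have "m x y \<le> g w \<or> m y z \<le> g w"
      using tree_min_le assms unfolding m_def by blast
    then show "min (m x y) (m y z) \<le> g w" by auto
  qed auto
  moreover have "m x y \<le> g y" "m y z \<le> g y"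
    unfolding m_def by (rule tree_min_le; use assms in simp)+
  ultimately have "m x y + m y z \<le> m x z + g y" by linarith
  moreover have "tree_pseudodist g x y = g x + g y - 2 * m x y" for x y
    unfolding tree_pseudodist_def m_def ..
  ultimately show ?thesis by simp
qed

lemma equiv_tree_rel: "equiv {0..1} (tree_rel g)"
proof (rule equivI)
  show "refl_on {0..1} (tree_rel g)"
    by (auto simp: refl_on_def tree_rel_def tree_pseudodist_refl)
  show "sym (tree_rel g)"
    by (auto simp: sym_def tree_rel_def tree_pseudodist_commute)
  show "trans (tree_rel g)"
  proof (rule transI)
    fix x y z assume "(x, y) \<in> tree_rel g" "(y, z) \<in> tree_rel g"
    then show "(x, z) \<in> tree_rel g"
      using tree_pseudodist_triangle[of x y z] tree_pseudodist_nonneg[of x z]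
      by (simp add: tree_rel_def)
  qed
qed (auto simp: tree_rel_def)

lemma tree_dist_class:
  assumes "A \<in> tree g" "B \<in> tree g" "x \<in> A" "y \<in> B"
  shows "tree_dist g A B = tree_pseudodist g x y"
proof -
  have eq: "tree_pseudodist g x' y' = tree_pseudodist g x y" if "x' \<in> A" "y' \<in> B" for x' y'
  proof -
    have r: "(x, x') \<in> tree_rel g" "(y, y') \<in> tree_rel g"
      using that assms quotient_eq_iff[OF equiv_tree_rel] unfolding tree_def by blast+
    then have "tree_pseudodist g x x' = 0" "tree_pseudodist g y y' = 0"
      and I: "x \<in> {0..1}" "x' \<in> {0..1}" "y \<in> {0..1}" "y' \<in> {0..1}"
      by (auto simp: tree_rel_def)
    then show ?thesis
      using tree_pseudodist_triangle[OF I(1,2,3)] tree_pseudodist_triangle[OF I(2,4,3)]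
        tree_pseudodist_triangle[OF I(2,1,4)] tree_pseudodist_triangle[OF I(1,3,4)]
        tree_pseudodist_commute[of x' x] tree_pseudodist_commute[of y' y]
      by linarith
  qed
  have "(\<lambda>(x, y). tree_pseudodist g x y) ` (A \<times> B) = (\<lambda>_. tree_pseudodist g x y) ` (A \<times> B)"
    by (rule image_cong) (auto dest: eq)
  also have "\<dots> = {tree_pseudodist g x y}"
    using assms(3,4) by blast
  finally have "(\<lambda>(x, y). tree_pseudodist g x y) ` (A \<times> B) = {tree_pseudodist g x y}" .
  then show ?thesis by (simp add: tree_dist_def)
qed

text \<open>
  On \<open>tree g\<close> these are the metric axioms; the locale \<open>Metric_space\<close> would also require
  nonnegativity and symmetry outside the carrier.
\<close>

lemma tree_dist_metric:
  assumes ABC: "A \<in> tree g" "B \<in> tree g" "C \<in> tree g"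
  shows "0 \<le> tree_dist g A B"
    and "tree_dist g A B = tree_dist g B A"
    and "tree_dist g A B = 0 \<longleftrightarrow> A = B"
    and "tree_dist g A C \<le> tree_dist g A B + tree_dist g B C"
proof -
  have nonempty: "\<exists>x. x \<in> X" if "X \<in> tree g" for X
    using in_quotient_imp_non_empty[OF equiv_tree_rel] that unfolding tree_def by blast
  have sub: "x \<in> {0..1}" if "X \<in> tree g" "x \<in> X" for X x
    using in_quotient_imp_subset[OF equiv_tree_rel] that unfolding tree_def by blast
  obtain x y z where xyz: "x \<in> A" "y \<in> B" "z \<in> C"
    using nonempty ABC by meson
  note I = sub[OF ABC(1) xyz(1)] sub[OF ABC(2) xyz(2)] sub[OF ABC(3) xyz(3)]
  note d = tree_dist_class[OF ABC(1,2) xyz(1,2)] tree_dist_class[OF ABC(2,1) xyz(2,1)]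
    tree_dist_class[OF ABC(2,3) xyz(2,3)] tree_dist_class[OF ABC(1,3) xyz(1,3)]
  show "0 \<le> tree_dist g A B"
    unfolding d by (rule tree_pseudodist_nonneg[OF I(1,2)])
  show "tree_dist g A B = tree_dist g B A"
    unfolding d by (rule tree_pseudodist_commute)
  show "tree_dist g A C \<le> tree_dist g A B + tree_dist g B C"
    unfolding d by (rule tree_pseudodist_triangle[OF I])
  have "tree_dist g A B = 0 \<longleftrightarrow> (x, y) \<in> tree_rel g"
    unfolding d using I by (auto simp: tree_rel_def)
  also have "\<dots> \<longleftrightarrow> A = B"
    using quotient_eq_iff[OF equiv_tree_rel] ABC xyz unfolding tree_def by blast
  finally show "tree_dist g A B = 0 \<longleftrightarrow> A = B" .
qed

end

text \<open>
  A minimum point \<open>a\<close> of \<open>f\<close> is chosen arbitrarily; another choice rotates the excursion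
  function and gives an isometric tree.
\<close>

definition excursion_of :: "(complex \<Rightarrow> real) \<Rightarrow> real \<Rightarrow> real" where
  "excursion_of f x = (let a = arg_min_on f circle in f (a * circle_pt x) - f a)"

lemma excursion_excursion_of:
  assumes "continuous_on circle f"
  shows "excursion (excursion_of f)"
proof -
  define a where "a = arg_min_on f circle"
  have "circle \<noteq> {}" by (simp add: circle_def)
  then obtain b where "b \<in> circle" "\<forall>z\<in>circle. f b \<le> f z"
    using continuous_attains_inf[OF _ _ assms] by (auto simp: circle_def)
  then have "is_arg_min f (\<lambda>x. x \<in> circle) b"
    by (auto simp: is_arg_min_linorder)
  then have "is_arg_min f (\<lambda>x. x \<in> circle) a"
    unfolding a_def arg_min_on_def arg_min_def by (rule someI)
  then have a: "a \<in> circle" "\<And>z. z \<in> circle \<Longrightarrow> f a \<le> f z"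
    by (auto simp: is_arg_min_linorder)
  have in_circle: "a * circle_pt x \<in> circle" for x
    using a(1) by (simp add: circle_def circle_pt_def norm_mult)
  have "continuous_on {0..1} (\<lambda>x. a * circle_pt x)"
    unfolding circle_pt_def by (intro continuous_intros)
  then have "continuous_on {0..1} (\<lambda>x. f (a * circle_pt x))"
    by (rule continuous_on_compose2[OF assms]) (use in_circle in blast)
  then have "continuous_on {0..1} (\<lambda>x. f (a * circle_pt x) - f a)"
    by (intro continuous_intros)
  moreover have "0 \<le> f (a * circle_pt x) - f a" for x
    using a(2)[OF in_circle] by simp
  moreover have "circle_pt 0 = 1" "circle_pt 1 = 1"
    by (simp_all add: circle_pt_def)
  moreover have "excursion_of f = (\<lambda>x. f (a * circle_pt x) - f a)"
    by (simp add: fun_eq_iff excursion_of_def a_def Let_def)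
  ultimately show ?thesis
    unfolding excursion_def by simp
qed

definition tree_dim :: "(complex \<Rightarrow> real) \<Rightarrow> ereal" where
  "tree_dim f = upper_box_dim (tree (excursion_of f)) (tree_dist (excursion_of f))"

section \<open>Variation index\<close>

definition p_variation :: "real \<Rightarrow> (real \<Rightarrow> real) \<Rightarrow> ereal" where
  "p_variation p g =
     (SUP xs\<in>{xs. sorted_wrt (<) xs \<and> set xs \<subseteq> {0..1}}.
        ereal (\<Sum>i<length xs - 1. \<bar>g (xs ! i) - g (xs ! Suc i)\<bar> powr p))"

definition variation_index :: "(real \<Rightarrow> real) \<Rightarrow> ereal" where
  "variation_index g =
     (let P = {p. 1 \<le> p \<and> p_variation p g = \<infinity>}
      in if P = {} then 1 else SUP p\<in>P. ereal p)"

section \<open>Maximum of a set\<close>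

definition is_maximum :: "ereal \<Rightarrow> ereal set \<Rightarrow> bool" where
  "is_maximum m S \<longleftrightarrow> m \<in> S \<and> (\<forall>s\<in>S. s \<le> m)"

end

theory Submission
  imports Defs
begin

text \<open>
  The tree dimension, the variation index and the best graph dimension are all read off from one
  combinatorial quantity: the maximal number \<open>M(\<delta>)\<close> of pairwise disjoint connected pieces of the
  domain on each of which the function oscillates by at least \<open>\<delta>\<close>. This number is visibly invariant
  under homeomorphisms, and cutting the circle open at a point destroys at most one piece, so up
  to an additive constant it does not matter whether it is taken on the circle, for \<open>f \<circ> \<tau>\<close> on
  \<open>[0,1]\<close>, or for the excursion function (\<open>osc_bound_circle_iff\<close>). Let \<open>D\<close> be the critical
  exponent of the bound \<open>M(\<delta>) \<le> K \<delta> powr (-q)\<close>.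

  The tree dimension is \<open>D\<close>. If \<open>n\<close> points of the tree are \<open>r\<close>-separated, then between any two
  consecutive ones the function oscillates by more than \<open>r / 2\<close>, which gives about \<open>n\<close> disjoint
  pieces (\<open>separated_imp_osc_packing\<close>). Conversely, the high points of \<open>n\<close> disjoint upward moves of
  size \<open>\<delta>\<close> are \<open>\<delta>\<close>-separated in the tree, because the low point of the later move lies between two
  of them; downward moves are symmetric (\<open>osc_packing_imp_separated\<close>).

  The variation index is \<open>D\<close>. Finite \<open>p\<close>-variation bounds \<open>M(\<delta>) \<delta>\<^sup>p\<close>. In the other direction,
  \<open>M(\<delta>) \<le> K \<delta> powr (-q)\<close> is a weak type bound on the increments over any partition, and it becomes a
  bound on the sum of their \<open>p\<close>-th powers for every \<open>p > q\<close> (\<open>sum_powr_le_of_weak_type\<close>).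

  For \<open>p < 1\<close> the index says nothing, but \<open>D \<ge> 1\<close> since \<open>f\<close> is not constant
  (\<open>tree_box_dim_ge_1\<close>).

  No graph has dimension above \<open>2 - 1 / D\<close>: by the same weak type bound, for every \<open>p > D\<close> the
  oscillations over \<open>n\<close> columns of width \<open>1 / n\<close> have total \<open>O(n powr (1 - 1/p))\<close>, so
  \<open>O(n powr (2 - 1/p))\<close> boxes of side \<open>1 / n\<close> suffice.

  The value \<open>2 - 1 / D\<close> is attained. Choose packings with \<open>M\<^sub>j \<ge> \<delta>\<^sub>j powr (-q\<^sub>j)\<close> where
  \<open>q\<^sub>j\<close> tends to \<open>D\<close>, and change time so that each of the \<open>M\<^sub>j\<close> pieces gets length at least \<open>\<rho>\<^sub>j = c\<^sub>j / M\<^sub>j\<close>. Above every piece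
  the graph then has height \<open>\<delta>\<^sub>j\<close>, which costs about \<open>\<delta>\<^sub>j / \<rho>\<^sub>j\<close> sets of diameter \<open>\<rho>\<^sub>j\<close>, and sets over
  distant pieces are different. The total is about \<open>M\<^sub>j \<delta>\<^sub>j / \<rho>\<^sub>j\<close>, which is at least of order
  \<open>M\<^sub>j\<close> to the power \<open>2 - 1 / q\<^sub>j\<close>. A mixture with weights \<open>c\<^sub>j\<close> serves all \<open>j\<close> at once, and if \<open>M\<^sub>j\<close>
  grows fast enough the factors \<open>c\<^sub>j\<close> disappear in the logarithmic limit (\<open>time_change_graph_large\<close>).
\<close>

section \<open>Oscillation packings\<close>

text \<open>
  The pieces are arbitrary connected sets rather than intervals with chosen endpoints, so that the
  notion makes sense on the circle and on \<open>[0,1]\<close> and is carried along by every homeomorphism. Since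
  \<open>x\<close> and \<open>y\<close> range over ordered pairs, rises and falls of size \<open>\<delta>\<close> both count.
\<close>

definition osc_packing ::
  "'a::topological_space set \<Rightarrow> ('a \<Rightarrow> real) \<Rightarrow> real \<Rightarrow> 'a set set \<Rightarrow> bool" where
  "osc_packing S f \<delta> \<C> \<longleftrightarrow> finite \<C> \<and> disjoint \<C> \<and>
     (\<forall>C\<in>\<C>. C \<subseteq> S \<and> connected C \<and> (\<exists>x\<in>C. \<exists>y\<in>C. \<delta> \<le> f y - f x))"

definition osc_bound :: "'a::topological_space set \<Rightarrow> ('a \<Rightarrow> real) \<Rightarrow> real \<Rightarrow> bool" where
  "osc_bound S f q \<longleftrightarrow>
     (\<exists>K. \<forall>\<delta>>0. \<forall>\<C>. osc_packing S f \<delta> \<C> \<longrightarrow> real (card \<C>) \<le> K * \<delta> powr (-q))"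

lemma osc_packingD:
  assumes "osc_packing S f \<delta> \<C>" "C \<in> \<C>"
  shows "C \<subseteq> S" and "connected C" and "\<exists>x\<in>C. \<exists>y\<in>C. \<delta> \<le> f y - f x"
  using assms unfolding osc_packing_def by simp_all

lemma osc_packing_inter:
  assumes "osc_packing S f \<delta> \<C>" "C \<in> \<C>" "D \<in> \<C>" "x \<in> C" "x \<in> D"
  shows "C = D"
  using assms unfolding osc_packing_def by (metis disjointD disjoint_iff)

lemma osc_packing_endpoints:
  fixes g :: "real \<Rightarrow> real"
  assumes P: "osc_packing S g \<delta> \<C>" and "0 < \<delta>"
  obtains l u where "\<And>C. C \<in> \<C> \<Longrightarrow> l C \<in> C" "\<And>C. C \<in> \<C> \<Longrightarrow> u C \<in> C" "\<And>C. C \<in> \<C> \<Longrightarrow> l C < u C"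
    "\<And>C. C \<in> \<C> \<Longrightarrow> \<delta> \<le> \<bar>g (l C) - g (u C)\<bar>"
proof -
  have "\<exists>l u. l \<in> C \<and> u \<in> C \<and> l < u \<and> \<delta> \<le> \<bar>g l - g u\<bar>" if C: "C \<in> \<C>" for C
  proof -
    obtain x y where xy: "x \<in> C" "y \<in> C" "\<delta> \<le> g y - g x" using osc_packingD(3)[OF P C] by blast
    then have "x < y \<or> y < x" using \<open>0 < \<delta>\<close> by (cases x y rule: linorder_cases) auto
    then show ?thesis using xy by (metis abs_ge_self abs_minus_commute order_trans)
  qed
  then show ?thesis using that by metis
qed

lemma osc_packing_subset:
  assumes "osc_packing S f \<delta> \<C>" "\<D> \<subseteq> \<C>"
  shows "osc_packing S f \<delta> \<D>"
  using assms unfolding osc_packing_def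
  by (meson finite_subset pairwise_subset subsetD)

lemma osc_packing_antimono:
  assumes "osc_packing S f \<delta> \<C>" "\<epsilon> \<le> \<delta>"
  shows "osc_packing S f \<epsilon> \<C>"
  using assms unfolding osc_packing_def by (meson order_trans)

lemma osc_packing_image:
  assumes P: "osc_packing S f \<delta> \<C>" and cont: "continuous_on S \<phi>" and inj: "inj_on \<phi> S"
    and sub: "\<phi> ` S \<subseteq> S'" and eq: "\<And>x. x \<in> S \<Longrightarrow> f' (\<phi> x) = f x + c"
  shows "osc_packing S' f' \<delta> ((`) \<phi> ` \<C>)" and "card ((`) \<phi> ` \<C>) = card \<C>"
proof -
  note CS = osc_packingD[OF P]
  have "inj_on ((`) \<phi>) \<C>"
    using inj_on_image_Pow[OF inj] CS(1) by (meson PowI inj_on_subset subsetI)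
  then show "card ((`) \<phi> ` \<C>) = card \<C>" by (rule card_image)
  have "disjoint ((`) \<phi> ` \<C>)"
  proof (rule disjointI)
    fix A B assume "A \<in> (`) \<phi> ` \<C>" "B \<in> (`) \<phi> ` \<C>" "A \<noteq> B"
    then obtain C D where CD: "C \<in> \<C>" "D \<in> \<C>" "A = \<phi> ` C" "B = \<phi> ` D" "C \<noteq> D" by blast
    then have "C \<inter> D = {}" using P unfolding osc_packing_def by (meson disjointD)
    then show "A \<inter> B = {}"
      using inj_on_image_Int[OF inj CS(1) CS(1)] CD by (metis image_empty)
  qed
  moreover have "\<phi> ` C \<subseteq> S' \<and> connected (\<phi> ` C) \<and> (\<exists>x\<in>\<phi> ` C. \<exists>y\<in>\<phi> ` C. \<delta> \<le> f' y - f' x)"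
    if "C \<in> \<C>" for C
  proof (intro conjI)
    show "\<phi> ` C \<subseteq> S'" using CS(1)[OF that] sub by blast
    show "connected (\<phi> ` C)"
      using connected_continuous_image[OF continuous_on_subset[OF cont CS(1)] CS(2)] that by blast
    obtain x y where "x \<in> C" "y \<in> C" "\<delta> \<le> f y - f x" using CS(3)[OF \<open>C \<in> \<C>\<close>] by blast
    then show "\<exists>x\<in>\<phi> ` C. \<exists>y\<in>\<phi> ` C. \<delta> \<le> f' y - f' x"
      using CS(1)[OF that] eq by (intro bexI[of _ "\<phi> x"] bexI[of _ "\<phi> y"]) (auto simp: subset_iff)
  qed
  ultimately show "osc_packing S' f' \<delta> ((`) \<phi> ` \<C>)"
    using P unfolding osc_packing_def by auto
qed

text \<open>
  Disjointness leaves at most one member that contains \<open>p\<close>. This is the cost of cutting the circle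
  open, and of gluing the two ends of the interval together.
\<close>

lemma osc_packing_remove_point:
  assumes P: "osc_packing S f \<delta> \<C>"
  obtains \<D> where "osc_packing (S - {p}) f \<delta> \<D>" "card \<C> \<le> card \<D> + 1"
proof
  have "C = D" if "C \<in> \<C>" "D \<in> \<C>" "p \<in> C" "p \<in> D" for C D
    using that P unfolding osc_packing_def by (metis disjointD IntI empty_iff)
  then have "card {C\<in>\<C>. p \<in> C} \<le> 1"
    using P card_le_Suc0_iff_eq[of "{C\<in>\<C>. p \<in> C}"] by (auto simp: osc_packing_def)
  moreover have "{C\<in>\<C>. p \<notin> C} \<union> {C\<in>\<C>. p \<in> C} = \<C>" by blast
  then have "card \<C> \<le> card {C\<in>\<C>. p \<notin> C} + card {C\<in>\<C>. p \<in> C}"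
    using card_Un_le[of "{C\<in>\<C>. p \<notin> C}" "{C\<in>\<C>. p \<in> C}"] by simp
  ultimately show "card \<C> \<le> card {C\<in>\<C>. p \<notin> C} + 1" by linarith
  show "osc_packing (S - {p}) f \<delta> {C\<in>\<C>. p \<notin> C}"
    using osc_packing_subset[OF P, of "{C\<in>\<C>. p \<notin> C}"] unfolding osc_packing_def by blast
qed

lemma osc_packing_delta_le:
  assumes "osc_packing S f \<delta> \<C>" "\<C> \<noteq> {}" "\<And>x. x \<in> S \<Longrightarrow> \<bar>f x\<bar> \<le> B"
  shows "\<delta> \<le> 2 * B"
proof -
  obtain C where "C \<in> \<C>" using assms(2) by blast
  then obtain x y where "x \<in> S" "y \<in> S" "\<delta> \<le> f y - f x"
    using assms(1) unfolding osc_packing_def by blast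
  then show ?thesis using assms(3)[of x] assms(3)[of y] by linarith
qed

text \<open>
  Used with \<open>B\<close> twice a bound on the function: constants can then be absorbed into a multiple of
  \<open>\<delta> powr (-q)\<close>, since no nonempty packing exists for larger \<open>\<delta>\<close>.
\<close>

lemma powr_mult_minus_ge_1:
  fixes \<delta> B q :: real
  assumes "0 < \<delta>" "\<delta> \<le> B" "0 \<le> q"
  shows "1 \<le> B powr q * \<delta> powr (-q)"
proof -
  have "\<delta> powr q * \<delta> powr (-q) \<le> B powr q * \<delta> powr (-q)"
    using assms by (intro mult_right_mono powr_mono2) auto
  then show ?thesis using assms by (simp flip: powr_add)
qed

lemma osc_bound_transfer:
  assumes step: "\<And>\<delta> \<C>. osc_packing S f \<delta> \<C> \<Longrightarrow> \<exists>\<D>. osc_packing S' f' \<delta> \<D> \<and> card \<C> \<le> card \<D> + 1"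
    and B: "\<And>x. x \<in> S \<Longrightarrow> \<bar>f x\<bar> \<le> B" and q: "0 \<le> q" and ob: "osc_bound S' f' q"
  shows "osc_bound S f q"
proof -
  obtain K where K: "\<And>\<delta> \<D>. 0 < \<delta> \<Longrightarrow> osc_packing S' f' \<delta> \<D> \<Longrightarrow> real (card \<D>) \<le> K * \<delta> powr (-q)"
    using ob unfolding osc_bound_def by blast
  have "real (card \<C>) \<le> (\<bar>K\<bar> + (2 * B) powr q) * \<delta> powr (-q)" if d: "0 < \<delta>" and P: "osc_packing S f \<delta> \<C>" for \<delta> \<C>
  proof (cases "\<C> = {}")
    case False
    obtain \<D> where D: "osc_packing S' f' \<delta> \<D>" "card \<C> \<le> card \<D> + 1" using step[OF P] by blast
    have "real (card \<C>) \<le> K * \<delta> powr (-q) + 1" using K[OF d D(1)] D(2) by linarith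
    also have "\<dots> \<le> \<bar>K\<bar> * \<delta> powr (-q) + (2 * B) powr q * \<delta> powr (-q)"
      using powr_mult_minus_ge_1[OF d osc_packing_delta_le[OF P False B] q]
      by (intro add_mono mult_right_mono) auto
    finally show ?thesis by (simp add: algebra_simps)
  qed simp
  then show ?thesis unfolding osc_bound_def by blast
qed

text \<open>
  Only small \<open>\<delta>\<close> matter: for \<open>\<delta> \<ge> \<epsilon>\<close> a packing is in particular one at scale \<open>\<epsilon>\<close>, and it is empty once
  \<open>\<delta>\<close> exceeds \<open>2 * B\<close>.
\<close>

lemma osc_bound_local:
  assumes small: "\<And>\<delta> \<C>. 0 < \<delta> \<Longrightarrow> \<delta> < \<epsilon> \<Longrightarrow> osc_packing S f \<delta> \<C> \<Longrightarrow> real (card \<C>) \<le> K * \<delta> powr (-q)"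
    and large: "\<And>\<C>. osc_packing S f \<epsilon> \<C> \<Longrightarrow> card \<C> \<le> L"
    and B: "\<And>x. x \<in> S \<Longrightarrow> \<bar>f x\<bar> \<le> B" and q: "0 \<le> q"
  shows "osc_bound S f q"
proof -
  have "real (card \<C>) \<le> (\<bar>K\<bar> + L * (2 * B) powr q) * \<delta> powr (-q)" if d: "0 < \<delta>" and P: "osc_packing S f \<delta> \<C>" for \<delta> \<C>
  proof (cases "\<C> = {} \<or> \<delta> < \<epsilon>")
    case False
    then have "card \<C> \<le> L" using large osc_packing_antimono[OF P] by fastforce
    then have "real (card \<C>) \<le> real L * 1" by simp
    also have "\<dots> \<le> L * ((2 * B) powr q * \<delta> powr (-q))"
      using powr_mult_minus_ge_1[OF d osc_packing_delta_le[OF P _ B] q] False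
      by (intro mult_left_mono) (blast, simp)
    also have "\<dots> \<le> (\<bar>K\<bar> + L * (2 * B) powr q) * \<delta> powr (-q)" by (simp add: algebra_simps)
    finally show ?thesis .
  next
    case True
    show ?thesis
    proof (cases "\<C> = {}")
      case False
      then have "real (card \<C>) \<le> K * \<delta> powr (-q)" using small d P True by blast
      also have "\<dots> \<le> (\<bar>K\<bar> + L * (2 * B) powr q) * \<delta> powr (-q)"
        by (intro mult_right_mono) (auto intro: add_increasing2)
      finally show ?thesis .
    qed simp
  qed
  then show ?thesis unfolding osc_bound_def by blast
qed

lemma connected_real_Icc_subset:
  fixes C :: "real set"
  assumes "connected C" "x \<in> C" "y \<in> C"
  shows "{min x y..max x y} \<subseteq> C"
  using connectedD_interval[OF assms(1,2,3)] connectedD_interval[OF assms(1,3,2)]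
  by (auto simp: min_def max_def split: if_splits)

text \<open>
  By uniform continuity every member has length at least some \<open>\<eta>\<close>, so it contains a point of a fixed
  grid of mesh below \<open>\<eta>\<close>, and disjoint members contain different grid points.
\<close>

lemma osc_packing_interval_bounded:
  fixes h :: "real \<Rightarrow> real"
  assumes cont: "continuous_on {0..1} h" and "0 < \<delta>"
  shows "\<exists>L. \<forall>\<C>. osc_packing {0..1} h \<delta> \<C> \<longrightarrow> card \<C> \<le> L"
proof -
  have "uniformly_continuous_on {0..1} h"
    using compact_uniformly_continuous[OF cont] by simp
  then obtain \<eta> where \<eta>: "0 < \<eta>"
    "\<And>x y. x \<in> {0..1} \<Longrightarrow> y \<in> {0..1} \<Longrightarrow> \<bar>y - x\<bar> < \<eta> \<Longrightarrow> \<bar>h y - h x\<bar> < \<delta>"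
    using \<open>0 < \<delta>\<close> unfolding uniformly_continuous_on_def dist_real_def by metis
  obtain n where n: "0 < n" "1 / real n < \<eta>"
    using \<eta>(1) by (metis inverse_eq_divide reals_Archimedean zero_less_Suc)
  have "card \<C> \<le> n + 1" if P: "osc_packing {0..1} h \<delta> \<C>" for \<C>
  proof -
    have "\<exists>k\<in>{0..n}. real k / n \<in> C" if "C \<in> \<C>" for C
    proof -
      note C = osc_packingD[OF P that]
      obtain x y where xy: "x \<in> C" "y \<in> C" "\<delta> \<le> h y - h x" using C(3) by blast
      have "\<eta> \<le> \<bar>y - x\<bar>" using \<eta>(2)[of x y] xy C by (smt (verit) subsetD)
      then have len: "1 / n \<le> max x y - min x y" using n by linarith
      define k where "k = nat \<lceil>n * min x y\<rceil>"
      have xy01: "x \<in> {0..1}" "y \<in> {0..1}" using xy C by blast+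
      then have "real_of_int \<lceil>n * min x y\<rceil> = real k" unfolding k_def by simp
      then have k: "n * min x y \<le> k" "k \<le> n * min x y + 1" by linarith+
      then have "min x y \<le> k / n" using n by (simp add: field_simps)
      moreover have "k / n \<le> max x y"
      proof -
        have "k / n \<le> (n * min x y + 1) / n" using k(2) by (intro divide_right_mono) auto
        also have "\<dots> = min x y + 1 / n" using n by (simp add: field_simps)
        finally show ?thesis using len by linarith
      qed
      ultimately have "k / n \<in> C" using connected_real_Icc_subset[OF C(2) xy(1,2)] by auto
      moreover have "k \<le> n" using C(1) calculation n by (auto simp: field_simps)
      ultimately show ?thesis by auto
    qed
    then obtain k where k: "\<And>C. C \<in> \<C> \<Longrightarrow> k C \<in> {0..n} \<and> real (k C) / n \<in> C" by metis
    have "inj_on k \<C>"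
    proof
      fix C D assume "C \<in> \<C>" "D \<in> \<C>" "k C = k D"
      then have "C \<inter> D \<noteq> {}" using k by (metis IntI empty_iff)
      then show "C = D" using P \<open>C \<in> \<C>\<close> \<open>D \<in> \<C>\<close> unfolding osc_packing_def by (meson disjointD)
    qed
    then have "card \<C> \<le> card {0..n}" using k by (intro card_inj_on_le[of k]) auto
    then show ?thesis by simp
  qed
  then show ?thesis by blast
qed

section \<open>From counting large terms to summing powers\<close>

text \<open>
  If \<open>x\<close> has the least value among \<open>n\<close> indices, all \<open>n\<close> terms are at least \<open>a x\<close>. The
  hypothesis at \<open>\<delta> = a x\<close> therefore gives \<open>n \<le> K * a x powr (-q)\<close>, that is
  \<open>a x powr p \<le> (K / n) powr (p / q)\<close>. Removing the least term and repeating yields the sum on the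
  right, which is a partial sum of a convergent series when \<open>p > q\<close>.
\<close>

lemma sum_powr_le_of_weak_type:
  fixes a :: "'i \<Rightarrow> real"
  assumes "finite A" and "\<And>i. i \<in> A \<Longrightarrow> 0 \<le> a i"
    and "\<And>\<delta>. 0 < \<delta> \<Longrightarrow> real (card {i\<in>A. \<delta> \<le> a i}) \<le> K * \<delta> powr (-q)"
    and q: "0 < q" and p: "0 < p"
  shows "(\<Sum>i\<in>A. a i powr p) \<le> (\<Sum>n<card A. (K / real (Suc n)) powr (p / q))"
  using assms(1-3)
proof (induction rule: finite_ranking_induct[where f = "\<lambda>i. - a i"])
  case (insert x A)
  show ?case
  proof (cases "x \<in> A")
    case True
    then show ?thesis using insert by (simp add: insert_absorb)
  next
    case False
    have "real (card {i\<in>A. \<delta> \<le> a i}) \<le> K * \<delta> powr (-q)" if "0 < \<delta>" for \<delta>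
      using insert.prems(2)[OF that] insert.hyps(1)
        card_mono[of "{i\<in>insert x A. \<delta> \<le> a i}" "{i\<in>A. \<delta> \<le> a i}"] by fastforce
    then have IH: "(\<Sum>i\<in>A. a i powr p) \<le> (\<Sum>n<card A. (K / real (Suc n)) powr (p / q))"
      using insert by auto
    have "a x powr p \<le> (K / real (Suc (card A))) powr (p / q)"
    proof (cases "a x = 0")
      case False
      then have ax: "0 < a x" using insert.prems(1)[of x] by fastforce
      have "{i\<in>insert x A. a x \<le> a i} = insert x A" using insert.hyps(2) by auto
      then have "real (Suc (card A)) \<le> K * a x powr (-q)"
        using insert.prems(2)[OF ax] insert.hyps(1) \<open>x \<notin> A\<close> by simp
      then have "a x powr q \<le> K / real (Suc (card A))"
        using ax by (simp add: powr_minus field_simps)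
      then have "(a x powr q) powr (p / q) \<le> (K / real (Suc (card A))) powr (p / q)"
        using q p by (intro powr_mono2) auto
      then show ?thesis using q by (simp add: powr_powr)
    qed (use p in simp)
    then show ?thesis using IH insert.hyps(1) False by simp
  qed
qed simp

text \<open>
  Neighbouring closed intervals \<open>[t i, t (Suc i)]\<close> share an endpoint, but those with indices of one
  parity are disjoint and form a packing; this explains the factor 2.
\<close>

lemma card_large_increments_le:
  fixes t :: "nat \<Rightarrow> real"
  assumes mono: "\<And>i j. i < j \<Longrightarrow> j \<le> n \<Longrightarrow> t i < t j" and t01: "\<And>i. i \<le> n \<Longrightarrow> t i \<in> {0..1}"
    and a: "\<And>i. i < n \<Longrightarrow> \<exists>x\<in>{t i..t (Suc i)}. \<exists>y\<in>{t i..t (Suc i)}. a i \<le> h y - h x"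
    and M: "\<And>\<C>. osc_packing {0..1} h \<delta> \<C> \<Longrightarrow> real (card \<C>) \<le> M"
  shows "real (card {i. i < n \<and> \<delta> \<le> a i}) \<le> 2 * M"
proof -
  define A where "A b = {i. i < n \<and> \<delta> \<le> a i \<and> i mod 2 = b}" for b
  define I where "I i = {t i..t (Suc i)}" for i
  have disj: "I i \<inter> I j = {}" if "i \<in> A b" "j \<in> A b" "i < j" for i j b
  proof -
    have "Suc i \<noteq> j" using that unfolding A_def by (auto simp: mod_Suc split: if_splits)
    then show ?thesis using that mono[of "Suc i" j] by (auto simp: A_def I_def)
  qed
  have disj': "I i \<inter> I j = {}" if "i \<in> A b" "j \<in> A b" "i \<noteq> j" for i j b
    using disj[of i b j] disj[of j b i] that by (metis Int_commute nat_neq_iff)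
  have ne: "I i \<noteq> {}" if "i \<in> A b" for i b
    using that mono[of i "Suc i"] by (auto simp: I_def A_def)
  have le: "real (card (A b)) \<le> M" for b
  proof -
    have "inj_on I (A b)"
      by (rule inj_onI) (metis disj' ne Int_absorb)
    then have "card (I ` A b) = card (A b)" by (rule card_image)
    moreover have "osc_packing {0..1} h \<delta> (I ` A b)"
      unfolding osc_packing_def
    proof (intro conjI ballI)
      show "finite (I ` A b)" by (simp add: A_def)
      show "disjoint (I ` A b)"
        using disj' by (intro disjointI) (metis imageE)
      fix C assume "C \<in> I ` A b"
      then obtain i where i: "i \<in> A b" "C = I i" by blast
      then show "C \<subseteq> {0..1}" "connected C"
        using t01[of i] t01[of "Suc i"] by (auto simp: A_def I_def)
      show "\<exists>x\<in>C. \<exists>y\<in>C. \<delta> \<le> h y - h x"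
        using i a[of i] unfolding A_def I_def by (force intro: order_trans)
    qed
    ultimately show ?thesis using M by metis
  qed
  have "{i. i < n \<and> \<delta> \<le> a i} \<subseteq> A 0 \<union> A 1" by (auto simp: A_def)
  then have "card {i. i < n \<and> \<delta> \<le> a i} \<le> card (A 0) + card (A 1)"
    using card_mono[of "A 0 \<union> A 1" "{i. i < n \<and> \<delta> \<le> a i}"] card_Un_le[of "A 0" "A 1"]
    by (simp add: A_def)
  then show ?thesis using le[of 0] le[of 1] by linarith
qed

text \<open>
  The bound \<open>S\<close> is uniform in the partition. It is used twice: for partitions in the definition of
  the variation, and for the columns of width \<open>1 / n\<close> that cover a graph.
\<close>

lemma osc_bound_imp_sum_powr_bounded:
  assumes ob: "osc_bound {0..1} h q" and q: "0 < q" and p: "q < p"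
  obtains S where "\<And>n (t :: nat \<Rightarrow> real) a. \<lbrakk>\<And>i j. i < j \<Longrightarrow> j \<le> n \<Longrightarrow> t i < t j; \<And>i. i \<le> n \<Longrightarrow> t i \<in> {0..1};
      \<And>i. i < n \<Longrightarrow> 0 \<le> a i \<and> (\<exists>x\<in>{t i..t (Suc i)}. \<exists>y\<in>{t i..t (Suc i)}. a i \<le> h y - h x)\<rbrakk>
      \<Longrightarrow> (\<Sum>i<n. a i powr p) \<le> S"
proof -
  obtain K0 where K0: "\<And>\<delta> \<C>. 0 < \<delta> \<Longrightarrow> osc_packing {0..1} h \<delta> \<C> \<Longrightarrow> real (card \<C>) \<le> K0 * \<delta> powr (-q)"
    using ob unfolding osc_bound_def by blast
  define K where "K = 2 * \<bar>K0\<bar>"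
  have "summable (\<lambda>n. real n powr (-(p/q)))"
    using q p by (simp add: summable_real_powr_iff)
  then have "summable (\<lambda>n. K powr (p/q) * real (Suc n) powr (-(p/q)))"
    by (intro summable_mult) (subst summable_Suc_iff)
  then have sm: "summable (\<lambda>n. (K / real (Suc n)) powr (p/q))"
    by (simp only: K_def powr_divide powr_minus_divide) (simp add: powr_divide K_def)
  show ?thesis
  proof (rule that[of "\<Sum>n. (K / real (Suc n)) powr (p/q)"])
    fix n and t a :: "nat \<Rightarrow> real"
    assume t: "\<And>i j. i < j \<Longrightarrow> j \<le> n \<Longrightarrow> t i < t j" "\<And>i. i \<le> n \<Longrightarrow> t i \<in> {0..1}"
      and a: "\<And>i. i < n \<Longrightarrow> 0 \<le> a i \<and> (\<exists>x\<in>{t i..t (Suc i)}. \<exists>y\<in>{t i..t (Suc i)}. a i \<le> h y - h x)"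
    have "(\<Sum>i\<in>{..<n}. a i powr p) \<le> (\<Sum>m<card {..<n}. (K / real (Suc m)) powr (p / q))"
    proof (rule sum_powr_le_of_weak_type)
      fix \<delta> :: real assume "0 < \<delta>"
      have M: "real (card \<C>) \<le> \<bar>K0\<bar> * \<delta> powr (-q)" if "osc_packing {0..1} h \<delta> \<C>" for \<C>
        using K0[OF \<open>0 < \<delta>\<close> that] by (rule order_trans) (intro mult_right_mono; simp)
      have "real (card {i. i < n \<and> \<delta> \<le> a i}) \<le> 2 * (\<bar>K0\<bar> * \<delta> powr (-q))"
        by (rule card_large_increments_le[where t = t and h = h]) (use t a M in auto)
      then show "real (card {i\<in>{..<n}. \<delta> \<le> a i}) \<le> K * \<delta> powr (-q)"
        by (simp add: K_def)
    qed (use a q p in auto)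
    also have "\<dots> \<le> (\<Sum>n. (K / real (Suc n)) powr (p/q))"
      by (intro sum_le_suminf sm) auto
    finally show "(\<Sum>i<n. a i powr p) \<le> (\<Sum>n. (K / real (Suc n)) powr (p/q))" .
  qed
qed

section \<open>Circle and interval\<close>

lemma circle_pt_in_circle: "circle_pt t \<in> circle"
  by (simp add: circle_pt_def circle_def)

lemma continuous_on_circle_pt: "continuous_on A circle_pt"
  unfolding circle_pt_def by (intro continuous_intros)

definition circle_angle :: "complex \<Rightarrow> real" where
  "circle_angle z = Arg2pi z / (2 * pi)"

lemma circle_angle_in: "circle_angle z \<in> {0..1}"
  using Arg2pi[of z] by (auto simp: circle_angle_def)

lemma circle_pt_circle_angle:
  assumes "z \<in> circle"
  shows "circle_pt (circle_angle z) = z"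
  using Arg2pi_eq[of z] assms by (simp add: circle_pt_def circle_angle_def circle_def cis_conv_exp)

lemma continuous_on_circle_angle: "continuous_on (circle - {1}) circle_angle"
  unfolding circle_angle_def
proof (intro continuous_intros continuous_at_imp_continuous_on ballI)
  fix z assume z: "z \<in> circle - {1}"
  have "z \<notin> \<real>\<^sub>\<ge>\<^sub>0"
  proof
    assume "z \<in> \<real>\<^sub>\<ge>\<^sub>0"
    then obtain r where "z = of_real r" "0 \<le> r" by (auto simp: nonneg_Reals_def)
    then show False using z by (auto simp: circle_def)
  qed
  then show "isCont Arg2pi z" by (rule continuous_at_Arg2pi)
qed simp

text \<open>
  Removing the point \<open>0\<close> makes \<open>\<tau> \<circ> circle_pt\<close> injective on the interval; removing the point \<open>\<tau> 1\<close>
  makes its inverse continuous on the circle. Either way a packing loses at most one member. The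
  constant \<open>c\<close> is there because an excursion function is \<open>f\<close> minus its minimum, read along a
  rotated circle.
\<close>

lemma osc_bound_circle_iff:
  assumes hom: "homeomorphism circle circle \<tau> \<sigma>" and cont: "continuous_on circle f"
    and h: "\<And>x. x \<in> {0..1} \<Longrightarrow> h x = f (\<tau> (circle_pt x)) + c" and q: "0 \<le> q"
  shows "osc_bound {0..1} h q \<longleftrightarrow> osc_bound circle f q"
proof -
  have hm: "\<tau> ` circle = circle" "\<sigma> ` circle = circle" "continuous_on circle \<tau>"
    "continuous_on circle \<sigma>" "\<And>z. z \<in> circle \<Longrightarrow> \<sigma> (\<tau> z) = z" "\<And>z. z \<in> circle \<Longrightarrow> \<tau> (\<sigma> z) = z"
    using hom unfolding homeomorphism_def by auto
  have "compact circle" by (simp add: circle_def)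
  then obtain B where B: "\<And>z. z \<in> circle \<Longrightarrow> \<bar>f z\<bar> \<le> B"
    using continuous_on_compact_bound[OF _ cont] by auto
  have hB: "\<bar>h x\<bar> \<le> B + \<bar>c\<bar>" if "x \<in> {0..1}" for x
  proof -
    have "\<tau> (circle_pt x) \<in> circle" using hm(1) circle_pt_in_circle by blast
    from B[OF this] h[OF that] show ?thesis by linarith
  qed
  have inj: "inj_on (\<lambda>x. \<tau> (circle_pt x)) ({0..1} - {0})"
  proof
    fix x y :: real assume xy: "x \<in> {0..1} - {0}" "y \<in> {0..1} - {0}" "\<tau> (circle_pt x) = \<tau> (circle_pt y)"
    then have "circle_pt x = circle_pt y" using hm(5) circle_pt_in_circle by metis
    then show "x = y" using circle_pt_eq_iff[of x y] xy by auto
  qed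
  have to_circle: "\<exists>\<D>. osc_packing circle f \<delta> \<D> \<and> card \<C> \<le> card \<D> + 1"
    if P: "osc_packing {0..1} h \<delta> \<C>" for \<delta> \<C>
  proof -
    obtain \<D> where D: "osc_packing ({0..1} - {0}) h \<delta> \<D>" "card \<C> \<le> card \<D> + 1"
      using osc_packing_remove_point[OF P] by metis
    have "continuous_on ({0..1} - {0}) (\<lambda>x. \<tau> (circle_pt x))"
      by (rule continuous_on_compose2[OF hm(3) continuous_on_circle_pt]) (use circle_pt_in_circle in blast)
    from osc_packing_image[OF D(1) this inj, of circle f "-c"] D(2) show ?thesis
      using hm(1) circle_pt_in_circle h by fastforce
  qed
  have to_interval: "\<exists>\<D>. osc_packing {0..1} h \<delta> \<D> \<and> card \<C> \<le> card \<D> + 1"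
    if P: "osc_packing circle f \<delta> \<C>" for \<delta> \<C>
  proof -
    obtain \<D> where D: "osc_packing (circle - {\<tau> 1}) f \<delta> \<D>" "card \<C> \<le> card \<D> + 1"
      using osc_packing_remove_point[OF P] by metis
    have one: "1 \<in> circle" by (simp add: circle_def)
    have sub: "\<sigma> ` (circle - {\<tau> 1}) \<subseteq> circle - {1}"
      using hm one by (smt (verit) Diff_iff image_subset_iff imageI singletonD singletonI)
    have cont: "continuous_on (circle - {\<tau> 1}) (\<lambda>z. circle_angle (\<sigma> z))"
      by (rule continuous_on_compose2[OF continuous_on_circle_angle _ sub])
        (use hm(4) continuous_on_subset in blast)
    have inverse: "\<tau> (circle_pt (circle_angle (\<sigma> z))) = z" if "z \<in> circle" for z
      using circle_pt_circle_angle[of "\<sigma> z"] hm(2,6) that by (metis imageI)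
    have "inj_on (\<lambda>z. circle_angle (\<sigma> z)) (circle - {\<tau> 1})"
      by (rule inj_on_inverseI[of _ "\<lambda>x. \<tau> (circle_pt x)"]) (use inverse in auto)
    from osc_packing_image[OF D(1) cont this, of "{0..1}" h c] D(2) show ?thesis
      using circle_angle_in h inverse by (smt (verit) Diff_iff image_subset_iff)
  qed
  show ?thesis
  proof
    show "osc_bound circle f q" if "osc_bound {0..1} h q"
      using to_interval B q that by (rule osc_bound_transfer)
    show "osc_bound {0..1} h q" if "osc_bound circle f q"
      using to_circle hB q that by (rule osc_bound_transfer)
  qed
qed

section \<open>Covering numbers and box dimension\<close>

text \<open>
  The condition under the least-number operator in \<open>covering_number\<close>.
\<close>

definition r_cover :: "'a set \<Rightarrow> ('a \<Rightarrow> 'a \<Rightarrow> real) \<Rightarrow> real \<Rightarrow> 'a set set \<Rightarrow> bool" where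
  "r_cover X d r \<U> \<longleftrightarrow> finite \<U> \<and> X \<subseteq> \<Union>\<U> \<and> (\<forall>U\<in>\<U>. U \<subseteq> X \<and> (\<forall>x\<in>U. \<forall>y\<in>U. d x y \<le> r))"

lemma covering_number_le:
  assumes "r_cover X d r \<U>"
  shows "covering_number X d r \<le> card \<U>"
  unfolding covering_number_def by (rule Least_le) (use assms in \<open>auto simp: r_cover_def\<close>)

lemma covering_number_attained:
  assumes "r_cover X d r \<U>"
  obtains \<V> where "r_cover X d r \<V>" "card \<V> = covering_number X d r"
proof -
  have "\<exists>\<V>. finite \<V> \<and> card \<V> = covering_number X d r \<and> X \<subseteq> \<Union>\<V> \<and>
        (\<forall>U\<in>\<V>. U \<subseteq> X \<and> (\<forall>x\<in>U. \<forall>y\<in>U. d x y \<le> r))"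
    unfolding covering_number_def
    by (rule LeastI[where k = "card \<U>"]) (use assms in \<open>auto simp: r_cover_def\<close>)
  then show ?thesis using that unfolding r_cover_def by auto
qed

text \<open>
  The lower bound on covering numbers used throughout: \<open>m = 1\<close> is the case of separated sets, and for
  graphs \<open>m = 2\<close>.
\<close>

lemma card_le_mult_covering_number:
  assumes cov: "r_cover X d r \<U>" and P: "P \<subseteq> X"
    and m: "\<And>U. U \<subseteq> X \<Longrightarrow> (\<And>x y. x \<in> U \<Longrightarrow> y \<in> U \<Longrightarrow> d x y \<le> r) \<Longrightarrow> card (P \<inter> U) \<le> m"
  shows "card P \<le> m * covering_number X d r"
proof (cases "finite P")
  case True
  obtain \<V> where V: "r_cover X d r \<V>" "card \<V> = covering_number X d r"
    using covering_number_attained[OF cov] .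
  have "P = (\<Union>U\<in>\<V>. P \<inter> U)" using V(1) P unfolding r_cover_def by blast
  moreover have "card (\<Union>U\<in>\<V>. P \<inter> U) \<le> (\<Sum>U\<in>\<V>. card (P \<inter> U))"
    using V(1) unfolding r_cover_def by (intro card_UN_le) auto
  ultimately have "card P \<le> (\<Sum>U\<in>\<V>. card (P \<inter> U))" by simp
  also have "\<dots> \<le> (\<Sum>U\<in>\<V>. m)"
    using V(1) unfolding r_cover_def by (intro sum_mono m) auto
  finally show ?thesis using V(2) by (simp add: mult.commute)
qed simp

lemma covering_number_pos:
  assumes "r_cover X d r \<U>" "X \<noteq> {}"
  shows "0 < covering_number X d r"
proof -
  obtain \<V> where "r_cover X d r \<V>" "card \<V> = covering_number X d r"
    using covering_number_attained[OF assms(1)] .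
  then show ?thesis using assms(2) by (auto simp: r_cover_def card_gt_0_iff)
qed

text \<open>
  The balls of radius \<open>r\<close> around a separated set of maximal cardinality cover \<open>X\<close>.
\<close>

lemma r_cover_from_separated:
  assumes "\<And>x. x \<in> X \<Longrightarrow> d x x = 0" and sym: "\<And>x y. x \<in> X \<Longrightarrow> y \<in> X \<Longrightarrow> d x y = d y x"
    and tri: "\<And>x y z. x \<in> X \<Longrightarrow> y \<in> X \<Longrightarrow> z \<in> X \<Longrightarrow> d x z \<le> d x y + d y z"
    and "0 < r"
    and sep: "\<And>E. finite E \<Longrightarrow> E \<subseteq> X \<Longrightarrow> (\<And>x y. x \<in> E \<Longrightarrow> y \<in> E \<Longrightarrow> x \<noteq> y \<Longrightarrow> r < d x y) \<Longrightarrow> card E \<le> k"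
  obtains \<U> where "r_cover X d (2 * r) \<U>" "card \<U> \<le> k"
proof -
  define Q where "Q n \<longleftrightarrow> (\<exists>E. finite E \<and> E \<subseteq> X \<and> (\<forall>x\<in>E. \<forall>y\<in>E. x \<noteq> y \<longrightarrow> r < d x y) \<and> card E = n)" for n
  have "Q 0" unfolding Q_def by (rule exI[of _ "{}"]) simp
  have Qk: "n \<le> k" if "Q n" for n
  proof -
    obtain E where "finite E" "E \<subseteq> X" "\<forall>x\<in>E. \<forall>y\<in>E. x \<noteq> y \<longrightarrow> r < d x y" "card E = n"
      using \<open>Q n\<close> unfolding Q_def by blast
    then show ?thesis using sep[of E] by simp
  qed
  define n where "n = (GREATEST n. Q n)"
  have n: "Q n" "\<And>n'. Q n' \<Longrightarrow> n' \<le> n"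
    unfolding n_def
    using GreatestI_nat[of Q 0 k] Greatest_le_nat[of Q _ k] \<open>Q 0\<close> Qk by blast+
  obtain E where E: "finite E" "E \<subseteq> X" "\<forall>x\<in>E. \<forall>y\<in>E. x \<noteq> y \<longrightarrow> r < d x y" "card E = n"
    using n(1) unfolding Q_def by blast
  have near: "\<exists>e\<in>E. d e x \<le> r" if x: "x \<in> X" for x
  proof (rule ccontr)
    assume "\<not> ?thesis"
    then have far: "\<And>e. e \<in> E \<Longrightarrow> r < d e x" by force
    then have "x \<notin> E" using assms(1)[OF x] \<open>0 < r\<close> by force
    have "Q (Suc n)" unfolding Q_def
    proof (intro exI[of _ "insert x E"] conjI)
      show "\<forall>a\<in>insert x E. \<forall>b\<in>insert x E. a \<noteq> b \<longrightarrow> r < d a b"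
        using far E sym[OF x] by (fastforce simp: subset_iff)
    qed (use E x \<open>x \<notin> E\<close> in auto)
    then show False using n(2) by fastforce
  qed
  show ?thesis
  proof (rule that)
    have "d x y \<le> 2 * r" if "e \<in> E" "x \<in> X" "y \<in> X" "d e x \<le> r" "d e y \<le> r" for e x y
      using tri[of x e y] sym[of e x] that E(2) by fastforce
    then show "r_cover X d (2 * r) ((\<lambda>e. {x\<in>X. d e x \<le> r}) ` E)"
      unfolding r_cover_def using near E(1) by auto
    show "card ((\<lambda>e. {x\<in>X. d e x \<le> r}) ` E) \<le> k"
      using card_image_le[OF E(1)] E(4) Qk[OF n(1)] by (meson order_trans)
  qed
qed

lemma upper_box_dim_le:
  assumes pos: "\<forall>\<^sub>F r in at_right 0. 0 < covering_number X d r"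
    and le: "\<forall>\<^sub>F r in at_right 0. real (covering_number X d r) \<le> C * r powr (-s)"
  shows "upper_box_dim X d \<le> ereal s"
proof -
  let ?N = "\<lambda>r. real (covering_number X d r)"
  let ?u = "\<lambda>r::real. ln \<bar>C\<bar> / - ln r + s"
  \<comment> \<open>The constant \<open>C\<close> contributes \<open>ln C / - ln r\<close>, which tends to 0.\<close>
  have lim: "((\<lambda>r. ereal (?u r)) \<longlongrightarrow> ereal s) (at_right 0)"
  proof -
    have "filterlim (\<lambda>r::real. - ln r) at_top (at_right 0)"
      using ln_at_0 by (simp add: filterlim_uminus_at_top)
    then have "((\<lambda>r::real. ln \<bar>C\<bar> / - ln r) \<longlongrightarrow> 0) (at_right 0)"
      by (rule tendsto_divide_0[OF tendsto_const filterlim_at_top_imp_at_infinity])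
    then have "(?u \<longlongrightarrow> 0 + s) (at_right 0)" by (intro tendsto_intros)
    then show ?thesis by (simp add: lim_ereal)
  qed
  have "\<forall>\<^sub>F r in at_right 0. r < (1::real)"
    by (rule eventually_at_right_less[of 0, THEN eventually_mono, THEN eventually_rev_mp])
       (use eventually_at_right_real[of 0 1] in \<open>auto elim: eventually_mono\<close>)
  then have "\<forall>\<^sub>F r in at_right 0. ereal (ln (?N r) / - ln r) \<le> ereal (?u r)"
    using pos le eventually_at_right_less[of 0]
  proof eventually_elim
    case (elim r)
    have "0 < C * r powr (-s)" using elim by linarith
    then have C: "0 < C" using elim by (simp add: zero_less_mult_iff)
    have "ln (?N r) \<le> ln (C * r powr (-s))" using elim by simp
    also have "\<dots> = ln \<bar>C\<bar> + s * - ln r" using C elim by (simp add: ln_mult ln_powr)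
    finally have "ln (?N r) / - ln r \<le> (ln \<bar>C\<bar> + s * - ln r) / - ln r"
      using elim by (intro divide_right_mono) auto
    also have "\<dots> = ?u r" using elim by (simp add: field_simps)
    finally show ?case by simp
  qed
  then have "upper_box_dim X d \<le> Limsup (at_right 0) (\<lambda>r. ereal (?u r))"
    unfolding upper_box_dim_def by (rule Limsup_mono)
  also have "\<dots> = ereal s" by (rule lim_imp_Limsup[OF _ lim]) simp
  finally show ?thesis .
qed

lemma covering_number_le_of_upper_box_dim_less:
  assumes "upper_box_dim X d < ereal q"
  obtains \<epsilon> where "0 < \<epsilon>" "\<And>r. 0 < r \<Longrightarrow> r < \<epsilon> \<Longrightarrow> real (covering_number X d r) \<le> r powr (-q)"
proof -
  let ?N = "\<lambda>r. real (covering_number X d r)"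
  have "\<forall>\<^sub>F r in at_right 0. ereal (ln (?N r) / - ln r) < ereal q"
    using assms unfolding upper_box_dim_def by (rule Limsup_lessD)
  then obtain b where b: "0 < b" "\<And>r. 0 < r \<Longrightarrow> r < b \<Longrightarrow> ln (?N r) / - ln r < q"
    by (auto simp: eventually_at_right_field)
  show ?thesis
  proof (rule that[of "min b 1"])
    fix r :: real assume r: "0 < r" "r < min b 1"
    show "?N r \<le> r powr (-q)"
    proof (cases "?N r = 0")
      case False
      have "ln (?N r) < q * - ln r" using b(2)[of r] r by (simp add: field_simps)
      also have "\<dots> = ln (r powr (-q))" using r by (simp add: ln_powr)
      finally have "ln (?N r) < ln (r powr (-q))" .
      then show ?thesis using False r by (subst (asm) ln_less_cancel_iff) auto
    qed simp
  qed (use b in simp)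
qed

text \<open>
  A limit superior dominates the limit along any sequence of scales; the exponents may vary with the
  scale.
\<close>

lemma upper_box_dim_ge_of_seq:
  assumes \<rho>: "\<rho> \<longlonglongrightarrow> 0" "\<And>j. 0 < \<rho> j" "\<And>j. \<rho> j < 1" and s: "s \<longlonglongrightarrow> L"
    and N: "\<And>j. \<rho> j powr (- s j) \<le> real (covering_number X d (\<rho> j))"
  shows "ereal L \<le> upper_box_dim X d"
proof -
  let ?g = "\<lambda>r. ereal (ln (real (covering_number X d r)) / - ln r)"
  have "ereal (s j) \<le> ?g (\<rho> j)" for j
  proof -
    have "s j * - ln (\<rho> j) = ln (\<rho> j powr (- s j))" using \<rho>(2)[of j] by (simp add: ln_powr)
    also have "\<dots> \<le> ln (real (covering_number X d (\<rho> j)))"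
      using N[of j] \<rho>(2)[of j] by (intro ln_mono) auto
    finally show ?thesis using \<rho>(2,3)[of j] by (simp add: field_simps)
  qed
  then have "Limsup sequentially (\<lambda>j. ereal (s j)) \<le> Limsup sequentially (\<lambda>j. ?g (\<rho> j))"
    by (intro Limsup_mono always_eventually) simp
  moreover have "Limsup sequentially (\<lambda>j. ereal (s j)) = ereal L"
    by (rule lim_imp_Limsup) (use s in \<open>simp_all add: lim_ereal\<close>)
  moreover have "filterlim \<rho> (at_right 0) sequentially"
    unfolding filterlim_at
    using \<rho>(1,2) by (auto intro!: always_eventually simp: less_imp_neq[symmetric])
  then have "filtermap \<rho> sequentially \<le> at_right 0" by (simp add: filterlim_def)
  then have "Limsup (filtermap \<rho> sequentially) ?g \<le> Limsup (at_right 0) ?g"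
    unfolding Limsup_def by (intro INF_superset_mono) (auto simp: le_filter_def)
  moreover have "Limsup sequentially (\<lambda>j. ?g (\<rho> j)) \<le> Limsup (filtermap \<rho> sequentially) ?g"
    by (rule Limsup_filtermap_ge)
  ultimately show ?thesis unfolding upper_box_dim_def by simp
qed

section \<open>The dimension of the tree\<close>

lemma tree_pseudodist_attained:
  assumes cont: "continuous_on {0..1} g" and "x \<in> {0..1}" "y \<in> {0..1}"
  obtains z where "z \<in> {min x y..max x y}" "tree_pseudodist g x y = (g x - g z) + (g y - g z)"
proof -
  have "{min x y..max x y} \<subseteq> {0..1}" using assms by auto
  then obtain z where z: "z \<in> {min x y..max x y}" "\<And>w. w \<in> {min x y..max x y} \<Longrightarrow> g z \<le> g w"
    using continuous_attains_inf[OF compact_Icc _ continuous_on_subset[OF cont], of "min x y" "max x y"]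
    by fastforce
  have "(INF w\<in>{min x y..max x y}. g w) = g z"
    using z by (intro cInf_eq_minimum) auto
  then show ?thesis using that[OF z(1)] unfolding tree_pseudodist_def by simp
qed

lemma tree_pseudodist_ge:
  assumes cont: "continuous_on {0..1} g" and xy: "x \<in> {0..1}" "y \<in> {0..1}" and "z \<in> {min x y..max x y}"
  shows "(g x - g z) + (g y - g z) \<le> tree_pseudodist g x y"
  using tree_min_le[OF assms] unfolding tree_pseudodist_def by linarith

text \<open>
  If \<open>t\<close> and its successor in \<open>E\<close> have tree distance above \<open>r\<close>, then \<open>g\<close> at one of them exceeds the
  minimum in between by more than \<open>r / 2\<close>. The half-open intervals from each point of \<open>E\<close> to the next
  are disjoint. Omitting the right endpoint changes the oscillation arbitrarily little by continuity,
  and the value \<open>r / 4\<close> leaves room for this.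
\<close>

lemma separated_imp_osc_packing:
  assumes cont: "continuous_on {0..1} g" and E: "finite E" "E \<subseteq> {0..1}" and "0 < r"
    and sep: "\<And>x y. x \<in> E \<Longrightarrow> y \<in> E \<Longrightarrow> x \<noteq> y \<Longrightarrow> r < tree_pseudodist g x y"
  obtains \<C> where "osc_packing {0..1} g (r / 4) \<C>" "card E \<le> card \<C> + 1"
proof (cases "E = {}")
  case True
  then show ?thesis using that[of "{}"] by (simp add: osc_packing_def)
next
  case False
  define E' where "E' = E - {Max E}"
  define nx where "nx t = Min {s\<in>E. t < s}" for t
  have nx: "nx t \<in> E" "t < nx t" "\<And>s. s \<in> E \<Longrightarrow> t < s \<Longrightarrow> nx t \<le> s" if "t \<in> E'" for t
  proof -
    have "t < Max E" using that E(1) unfolding E'_def by (metis DiffE Max_ge insertI1 order_less_le)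
    then have "{s\<in>E. t < s} \<noteq> {}" using Max_in[OF E(1) False] by blast
    then have "nx t \<in> {s\<in>E. t < s}" unfolding nx_def using E(1) by (intro Min_in) auto
    then show "nx t \<in> E" "t < nx t" by auto
    show "nx t \<le> s" if "s \<in> E" "t < s" for s
      unfolding nx_def using that E(1) by (intro Min_le) auto
  qed
  define I where "I t = {t..<nx t}" for t
  have disj: "I t \<inter> I s = {}" if "t \<in> E'" "s \<in> E'" "t \<noteq> s" for s t
  proof -
    have "s \<in> E" "t \<in> E" using that by (auto simp: E'_def)
    then have "nx t \<le> s \<or> nx s \<le> t"
      using nx(3)[OF that(1), of s] nx(3)[OF that(2), of t] that(3) by linarith
    then show ?thesis by (auto simp: I_def)
  qed
  have inj: "inj_on I E'"
  proof (rule inj_onI, rule ccontr)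
    fix t s assume "t \<in> E'" "s \<in> E'" "I t = I s" "t \<noteq> s"
    then have "I t = {}" using disj by fastforce
    then show False using nx(2)[OF \<open>t \<in> E'\<close>] by (auto simp: I_def)
  qed
  have osc: "\<exists>x\<in>I t. \<exists>y\<in>I t. r / 4 \<le> g y - g x" if t: "t \<in> E'" for t
  proof -
    have tE: "t \<in> E" using t by (simp add: E'_def)
    have t01: "t \<in> {0..1}" "nx t \<in> {0..1}" using tE nx(1)[OF t] E(2) by auto
    have r: "r < tree_pseudodist g t (nx t)" using sep[OF tE nx(1)[OF t]] nx(2)[OF t] by simp
    obtain z where z: "z \<in> {t..nx t}" "tree_pseudodist g t (nx t) = (g t - g z) + (g (nx t) - g z)"
      using tree_pseudodist_attained[OF cont t01] nx(2)[OF t] by (auto simp: min_def max_def)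
    have approx: "\<exists>v\<in>I t. \<bar>g v - g w\<bar> \<le> r / 8" if w: "w \<in> {t..nx t}" for w
    proof (cases "w = nx t")
      case True
      have "continuous_on {t..nx t} g"
        by (rule continuous_on_subset[OF cont]) (use t01 in auto)
      then obtain e where e: "0 < e" "\<And>v. v \<in> {t..nx t} \<Longrightarrow> dist v (nx t) < e \<Longrightarrow> dist (g v) (g (nx t)) < r / 8"
        using \<open>0 < r\<close> nx(2)[OF t] unfolding continuous_on_iff
        by (metis atLeastAtMost_iff divide_pos_pos less_imp_le order_refl zero_less_numeral)
      define v where "v = max t (nx t - e / 2)"
      have "v \<in> I t" "v \<in> {t..nx t}" "dist v (nx t) < e"
        using e(1) nx(2)[OF t] by (auto simp: v_def I_def dist_real_def)
      then show ?thesis using e(2)[of v] True by (force simp: dist_real_def)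
    next
      case False
      then show ?thesis using w \<open>0 < r\<close> by (intro bexI[of _ w]) (auto simp: I_def)
    qed
    have "r / 2 < g t - g z \<or> r / 2 < g (nx t) - g z" using r z(2) by linarith
    moreover have "t \<in> {t..nx t}" "nx t \<in> {t..nx t}" using nx(2)[OF t] by auto
    ultimately obtain w where w: "w \<in> {t..nx t}" "r / 2 < g w - g z" by blast
    obtain v u where "v \<in> I t" "u \<in> I t" "\<bar>g v - g w\<bar> \<le> r / 8" "\<bar>g u - g z\<bar> \<le> r / 8"
      using approx[OF w(1)] approx[OF z(1)] by blast
    then show ?thesis using w(2) by (intro bexI[of _ u] bexI[of _ v]) (auto simp: abs_if split: if_splits)
  qed
  show ?thesis
  proof (rule that[of "I ` E'"])
    show "osc_packing {0..1} g (r / 4) (I ` E')"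
      unfolding osc_packing_def
    proof (intro conjI ballI)
      show "finite (I ` E')" using E(1) by (simp add: E'_def)
      show "disjoint (I ` E')" using disj by (intro disjointI) (metis imageE)
      fix C assume "C \<in> I ` E'"
      then obtain t where t: "t \<in> E'" "C = I t" by blast
      then show "C \<subseteq> {0..1}" "connected C"
        using E(2) nx(1)[OF t(1)] by (auto simp: I_def E'_def subset_iff)
      show "\<exists>x\<in>C. \<exists>y\<in>C. r / 4 \<le> g y - g x" using osc[OF t(1)] t(2) by simp
    qed
    have "card (I ` E') = card E'" using inj by (rule card_image)
    then show "card E \<le> card (I ` E') + 1"
      using E(1) False by (simp add: E'_def card_Diff_singleton)
  qed
qed

text \<open>
  Take the packing members in which the low point comes first. For two of them the low point
  of the right member lies between the two high points and is lower by \<open>\<delta>\<close> than one of these, so the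
  high points have tree distance at least \<open>\<delta>\<close>. For members in which the high point comes first the low
  point of the left member has this property. One of the two kinds makes up half of the packing.
\<close>

lemma osc_packing_imp_separated:
  assumes cont: "continuous_on {0..1} g" and P: "osc_packing {0..1} g \<delta> \<C>" and "0 < \<delta>"
  obtains E where "finite E" "E \<subseteq> {0..1}" "card \<C> \<le> 2 * card E"
    "\<And>x y. x \<in> E \<Longrightarrow> y \<in> E \<Longrightarrow> x \<noteq> y \<Longrightarrow> \<delta> \<le> tree_pseudodist g x y"
proof -
  have "\<forall>C\<in>\<C>. \<exists>x y. x \<in> C \<and> y \<in> C \<and> \<delta> \<le> g y - g x" using osc_packingD(3)[OF P] by blast
  then obtain lo hi where lh: "\<And>C. C \<in> \<C> \<Longrightarrow> lo C \<in> C" "\<And>C. C \<in> \<C> \<Longrightarrow> hi C \<in> C"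
    "\<And>C. C \<in> \<C> \<Longrightarrow> \<delta> \<le> g (hi C) - g (lo C)" by metis
  define up where "up = {C\<in>\<C>. lo C \<le> hi C}"
  define down where "down = {C\<in>\<C>. hi C \<le> lo C}"
  have fin: "finite \<C>" using P by (simp add: osc_packing_def)
  \<comment> \<open>Disjoint connected subsets of the line are linearly ordered.\<close>
  have order: "x < y' \<and> x' < y'" if "C \<in> \<C>" "D \<in> \<C>" "C \<noteq> D" "x \<in> C" "x' \<in> C" "y \<in> D" "y' \<in> D" "x < y"
    for C D x x' y y'
  proof -
    have *: "u \<noteq> v" if "u \<in> C" "v \<in> D" for u v
      using osc_packing_inter[OF P \<open>C \<in> \<C>\<close> \<open>D \<in> \<C>\<close>] \<open>C \<noteq> D\<close> that by blast
    have C: "{min x x'..max x x'} \<subseteq> C" and D: "{min y y'..max y y'} \<subseteq> D"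
      using connected_real_Icc_subset osc_packingD(2)[OF P] that by blast+
    have xy: "u < v" if "u \<in> {min x x'..max x x'}" "v \<in> {min y y'..max y y'}" for u v
    proof (rule ccontr)
      assume "\<not> u < v"
      show False
      proof (cases "min y y' \<le> max x x' \<and> min x x' \<le> max y y'")
        case True
        then have "max (min x x') (min y y') \<in> C \<inter> D" using C D by (auto simp: subset_iff)
        then show False using * by blast
      next
        case False
        then show False using that \<open>\<not> u < v\<close> \<open>x < y\<close> by auto
      qed
    qed
    show ?thesis using xy[of x y'] xy[of x' y'] by auto
  qed
  have sep: "\<delta> \<le> tree_pseudodist g (hi C) (hi D)"
    if CD: "C \<in> \<A>" "D \<in> \<A>" "hi C \<noteq> hi D" and \<A>: "\<A> = up \<or> \<A> = down" for C D \<A>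
  proof -
    have *: "\<delta> \<le> tree_pseudodist g (hi C) (hi D)" if CD: "C \<in> \<A>" "D \<in> \<A>" "hi C < hi D" for C D
    proof -
      have mem: "C \<in> \<C>" "D \<in> \<C>" using CD \<A> by (auto simp: up_def down_def)
      have 01: "hi C \<in> {0..1}" "hi D \<in> {0..1}" using mem lh(2) osc_packingD(1)[OF P] by blast+
      have ord: "hi C < lo D" "lo C < hi D"
        using order[OF mem _ lh(2)[OF mem(1)] lh(1)[OF mem(1)] lh(2)[OF mem(2)] lh(2)[OF mem(2)] CD(3)]
          order[OF mem _ lh(2)[OF mem(1)] lh(1)[OF mem(1)] lh(2)[OF mem(2)] lh(1)[OF mem(2)] CD(3)] CD(3)
        by auto
      obtain z where z: "z \<in> {hi C..hi D}" "\<delta> \<le> max (g (hi C)) (g (hi D)) - g z" "z = lo C \<or> z = lo D"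
        using \<A>
      proof
        assume "\<A> = up"
        then show ?thesis using that[of "lo D"] CD ord lh(3)[OF mem(2)] by (auto simp: up_def)
      next
        assume "\<A> = down"
        then show ?thesis using that[of "lo C"] CD ord lh(3)[OF mem(1)] by (auto simp: down_def)
      qed
      have "(g (hi C) - g w) + (g (hi D) - g w) \<le> tree_pseudodist g (hi C) (hi D)" if "w \<in> {hi C..hi D}" for w
        using tree_pseudodist_ge[OF cont 01, of w] that CD(3) by (auto simp: min_def max_def)
      from this[OF z(1)] this[of "hi C"] this[of "hi D"] CD(3) z(2)
      show ?thesis by (auto simp: max_def split: if_splits)
    qed
    show ?thesis
      using *[OF CD(1,2)] *[OF CD(2,1)] CD(3) tree_pseudodist_commute[of g "hi C" "hi D"]
        tree_pseudodist_commute[OF cont] by (metis linorder_neqE_linordered_idom)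
  qed
  have inj: "inj_on hi \<C>"
    by (rule inj_onI) (metis lh(2) osc_packing_inter[OF P])
  have sub: "hi ` \<C> \<subseteq> {0..1}" using lh(2) osc_packingD(1)[OF P] by blast
  have "up \<union> down = \<C>" by (auto simp: up_def down_def)
  then have "card \<C> \<le> card up + card down" using card_Un_le[of up down] by simp
  then consider "card \<C> \<le> 2 * card up" | "card \<C> \<le> 2 * card down" by linarith
  then obtain \<A> where A: "\<A> = up \<or> \<A> = down" "card \<C> \<le> 2 * card \<A>" by metis
  then have AC: "\<A> \<subseteq> \<C>" by (auto simp: up_def down_def)
  show ?thesis
  proof (rule that[of "hi ` \<A>"])
    show "finite (hi ` \<A>)" using AC fin finite_subset by blast
    show "hi ` \<A> \<subseteq> {0..1}" using AC sub by blast
    show "card \<C> \<le> 2 * card (hi ` \<A>)" using A(2) card_image[OF inj_on_subset[OF inj AC]] by simp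
    show "\<delta> \<le> tree_pseudodist g x y" if "x \<in> hi ` \<A>" "y \<in> hi ` \<A>" "x \<noteq> y" for x y
      using sep A(1) that by blast
  qed
qed

context
  fixes g :: "real \<Rightarrow> real"
  assumes cont: "continuous_on {0..1} g"
begin

abbreviation (input) tree_class where "tree_class x \<equiv> tree_rel g `` {x}"

lemma tree_class_in: "x \<in> {0..1} \<Longrightarrow> tree_class x \<in> tree g"
  unfolding tree_def by (rule quotientI)

lemma tree_dist_tree_class:
  assumes "x \<in> {0..1}" "y \<in> {0..1}"
  shows "tree_dist g (tree_class x) (tree_class y) = tree_pseudodist g x y"
  by (rule tree_dist_class[OF cont tree_class_in tree_class_in])
    (use assms equiv_class_self[OF equiv_tree_rel[OF cont]] in blast)+

lemma tree_cover:
  assumes "0 < r" and k: "\<And>\<C>. osc_packing {0..1} g (r / 4) \<C> \<Longrightarrow> card \<C> \<le> k"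
  obtains \<U> where "r_cover (tree g) (tree_dist g) (2 * r) \<U>" "card \<U> \<le> k + 1"
proof (rule r_cover_from_separated[of "tree g" "tree_dist g" r "k + 1"])
  note metric = tree_dist_metric[OF cont]
  show "tree_dist g A A = 0" if "A \<in> tree g" for A using metric(3)[OF that that that] by simp
  show "tree_dist g A B = tree_dist g B A" if "A \<in> tree g" "B \<in> tree g" for A B
    using metric(2) that by blast
  show "tree_dist g A C \<le> tree_dist g A B + tree_dist g B C" if "A \<in> tree g" "B \<in> tree g" "C \<in> tree g" for A B C
    using metric(4) that by blast
  fix \<E> assume E: "finite \<E>" "\<E> \<subseteq> tree g" "\<And>A B. A \<in> \<E> \<Longrightarrow> B \<in> \<E> \<Longrightarrow> A \<noteq> B \<Longrightarrow> r < tree_dist g A B"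
  have "\<exists>x\<in>{0..1}. A = tree_class x" if "A \<in> \<E>" for A
    using that E(2) unfolding tree_def by (auto elim!: quotientE)
  then obtain rep where rep: "\<And>A. A \<in> \<E> \<Longrightarrow> rep A \<in> {0..1}" "\<And>A. A \<in> \<E> \<Longrightarrow> A = tree_class (rep A)"
    by metis
  have inj: "inj_on rep \<E>" by (rule inj_onI) (metis rep(2))
  have "r < tree_pseudodist g x y" if "x \<in> rep ` \<E>" "y \<in> rep ` \<E>" "x \<noteq> y" for x y
  proof -
    obtain A B where AB: "A \<in> \<E>" "B \<in> \<E>" "x = rep A" "y = rep B"
      using \<open>x \<in> rep ` \<E>\<close> \<open>y \<in> rep ` \<E>\<close> by blast
    then have "tree_dist g A B = tree_pseudodist g x y"
      using tree_dist_tree_class[of x y] rep by metis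
    then show ?thesis using E(3)[of A B] AB \<open>x \<noteq> y\<close> by auto
  qed
  then obtain \<C> where "osc_packing {0..1} g (r / 4) \<C>" "card (rep ` \<E>) \<le> card \<C> + 1"
    using separated_imp_osc_packing[OF cont, of "rep ` \<E>" r] E(1) rep(1) \<open>0 < r\<close> by blast
  then show "card \<E> \<le> k + 1" using k card_image[OF inj] by fastforce
qed (use assms that in auto)

lemma tree_cover_exists:
  assumes "0 < r"
  obtains \<U> where "r_cover (tree g) (tree_dist g) r \<U>"
proof -
  obtain k where "\<And>\<C>. osc_packing {0..1} g (r / 2 / 4) \<C> \<Longrightarrow> card \<C> \<le> k"
    using osc_packing_interval_bounded[OF cont, of "r / 2 / 4"] assms by auto
  then obtain \<U> where "r_cover (tree g) (tree_dist g) (2 * (r / 2)) \<U>"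
    using tree_cover[of "r / 2" k] assms by (metis half_gt_zero)
  then show ?thesis using that by simp
qed

lemma tree_separated_card_le:
  assumes "0 < r" "finite E" "E \<subseteq> {0..1}"
    and sep: "\<And>x y. x \<in> E \<Longrightarrow> y \<in> E \<Longrightarrow> x \<noteq> y \<Longrightarrow> r < tree_pseudodist g x y"
  shows "card E \<le> covering_number (tree g) (tree_dist g) r"
proof -
  have inj: "inj_on tree_class E"
  proof (rule inj_onI, rule ccontr)
    fix x y assume xy: "x \<in> E" "y \<in> E" "tree_class x = tree_class y" "x \<noteq> y"
    then have "tree_pseudodist g x y = tree_dist g (tree_class x) (tree_class x)"
      using tree_dist_tree_class[of x y] subsetD[OF assms(3)] by simp
    also have "\<dots> = 0"
      using tree_dist_tree_class[of x x] xy subsetD[OF assms(3)] tree_pseudodist_refl[OF cont] by simp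
    finally show False using sep xy \<open>0 < r\<close> by fastforce
  qed
  obtain \<U> where "r_cover (tree g) (tree_dist g) r \<U>" using tree_cover_exists[OF assms(1)] .
  then have "card (tree_class ` E) \<le> 1 * covering_number (tree g) (tree_dist g) r"
  proof (rule card_le_mult_covering_number)
    show "tree_class ` E \<subseteq> tree g" using assms(3) tree_class_in by blast
    fix U assume U: "\<And>A B. A \<in> U \<Longrightarrow> B \<in> U \<Longrightarrow> tree_dist g A B \<le> r"
    have "A = B" if AB: "A \<in> tree_class ` E \<inter> U" "B \<in> tree_class ` E \<inter> U" for A B
    proof -
      obtain x y where xy: "x \<in> E" "y \<in> E" "A = tree_class x" "B = tree_class y" using AB by blast
      then have "tree_pseudodist g x y \<le> r"
        using U[of A B] AB tree_dist_tree_class[of x y] subsetD[OF assms(3)] by simp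
      then show ?thesis using sep[of x y] xy by fastforce
    qed
    then show "card (tree_class ` E \<inter> U) \<le> 1"
      using assms(2) by (simp add: card_le_Suc0_iff_eq)
  qed
  then show ?thesis using card_image[OF inj] by simp
qed

lemma tree_box_dim_le:
  assumes "osc_bound {0..1} g q" "0 \<le> q"
  shows "upper_box_dim (tree g) (tree_dist g) \<le> ereal q"
proof -
  obtain K where K: "\<And>\<delta> \<C>. 0 < \<delta> \<Longrightarrow> osc_packing {0..1} g \<delta> \<C> \<Longrightarrow> real (card \<C>) \<le> K * \<delta> powr (-q)"
    using assms(1) unfolding osc_bound_def by blast
  have ne: "tree g \<noteq> {}" using tree_class_in[of 0] by auto
  have pos: "0 < covering_number (tree g) (tree_dist g) r" if "0 < r" for r
    using tree_cover_exists[OF that] covering_number_pos ne by metis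
  have le: "real (covering_number (tree g) (tree_dist g) r) \<le> (\<bar>K\<bar> * 8 powr q + 1) * r powr (-q)"
    if r: "0 < r" "r < 1" for r
  proof -
    define k where "k = nat \<lfloor>\<bar>K\<bar> * (r / 8) powr (-q)\<rfloor>"
    have "card \<C> \<le> k" if "osc_packing {0..1} g (r / 2 / 4) \<C>" for \<C>
    proof -
      have "real (card \<C>) \<le> K * (r / 8) powr (-q)" using K[OF _ that] r by simp
      also have "\<dots> \<le> \<bar>K\<bar> * (r / 8) powr (-q)" by (intro mult_right_mono) auto
      finally show ?thesis unfolding k_def by linarith
    qed
    then obtain \<U> where U: "r_cover (tree g) (tree_dist g) (2 * (r / 2)) \<U>" "card \<U> \<le> k + 1"
      using tree_cover[of "r / 2" k] r by (metis half_gt_zero)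
    have "real (covering_number (tree g) (tree_dist g) r) \<le> real k + 1"
      using covering_number_le[OF U(1)] U(2) by simp
    also have "real k \<le> \<bar>K\<bar> * (r / 8) powr (-q)" unfolding k_def by simp
    also have "\<bar>K\<bar> * (r / 8) powr (-q) = \<bar>K\<bar> * 8 powr q * r powr (-q)"
      using r by (simp add: powr_divide powr_minus field_simps)
    also have "1 \<le> 1 powr q * r powr (-q)"
      using powr_mult_minus_ge_1[of r 1 q] r assms(2) by simp
    finally show ?thesis by (simp add: algebra_simps)
  qed
  have "\<forall>\<^sub>F r in at_right 0. 0 < r \<and> r < (1::real)"
    using eventually_at_right_real[of 0 1] by (auto elim: eventually_mono)
  then show ?thesis
    using pos le by (intro upper_box_dim_le[where C = "\<bar>K\<bar> * 8 powr q + 1"])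
      (auto elim!: eventually_mono)
qed

lemma osc_bound_of_tree_box_dim_less:
  assumes "upper_box_dim (tree g) (tree_dist g) < ereal q" "0 \<le> q"
  shows "osc_bound {0..1} g q"
proof -
  obtain \<epsilon> where \<epsilon>: "0 < \<epsilon>"
    "\<And>r. 0 < r \<Longrightarrow> r < \<epsilon> \<Longrightarrow> real (covering_number (tree g) (tree_dist g) r) \<le> r powr (-q)"
    using covering_number_le_of_upper_box_dim_less[OF assms(1)] by blast
  obtain B where B: "\<And>x. x \<in> {0..1} \<Longrightarrow> \<bar>g x\<bar> \<le> B"
    using continuous_on_compact_bound[OF _ cont] by auto
  obtain L where L: "\<And>\<C>. osc_packing {0..1} g \<epsilon> \<C> \<Longrightarrow> card \<C> \<le> L"
    using osc_packing_interval_bounded[OF cont \<epsilon>(1)] by blast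
  have "real (card \<C>) \<le> (2 * 2 powr q) * \<delta> powr (-q)"
    if d: "0 < \<delta>" "\<delta> < \<epsilon>" and P: "osc_packing {0..1} g \<delta> \<C>" for \<delta> \<C>
  proof -
    obtain E where E: "finite E" "E \<subseteq> {0..1}" "card \<C> \<le> 2 * card E"
      "\<And>x y. x \<in> E \<Longrightarrow> y \<in> E \<Longrightarrow> x \<noteq> y \<Longrightarrow> \<delta> \<le> tree_pseudodist g x y"
      using osc_packing_imp_separated[OF cont P d(1)] by blast
    have "card E \<le> covering_number (tree g) (tree_dist g) (\<delta> / 2)"
      using E(4) d by (intro tree_separated_card_le E(1,2)) fastforce+
    then have "real (card \<C>) \<le> 2 * real (covering_number (tree g) (tree_dist g) (\<delta> / 2))"
      using E(3) by linarith
    also have "\<dots> \<le> 2 * (\<delta> / 2) powr (-q)" using \<epsilon>(2)[of "\<delta> / 2"] d by simp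
    also have "\<dots> = (2 * 2 powr q) * \<delta> powr (-q)"
      using d by (simp add: powr_divide powr_minus field_simps)
    finally show ?thesis .
  qed
  then show ?thesis using L B assms(2) by (rule osc_bound_local)
qed

text \<open>
  The function \<open>g\<close> is 1-Lipschitz on the tree, so points at which it takes values at mutual distance
  \<open>2 * r\<close> are separated. By the intermediate value theorem there are about \<open>(g y - g x) / (2 * r)\<close>
  such points.
\<close>

lemma tree_box_dim_ge_1:
  assumes "x \<in> {0..1}" "y \<in> {0..1}" "g x < g y"
  shows "1 \<le> upper_box_dim (tree g) (tree_dist g)"
proof -
  define G where "G = g y - g x"
  have G: "0 < G" using assms by (simp add: G_def)
  have many: "G / (2 * r) \<le> real (covering_number (tree g) (tree_dist g) r)" if r: "0 < r" for r
  proof -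
    define m where "m = nat \<lfloor>G / (2 * r)\<rfloor>"
    have m: "real m \<le> G / (2 * r)" "G / (2 * r) \<le> real m + 1"
      using G r unfolding m_def by (simp, linarith)
    have "\<exists>w\<in>{0..1}. g w = g x + 2 * r * real k" if "k \<le> m" for k
    proof -
      have "real k \<le> G / (2 * r)" using m(1) that by linarith
      then have "2 * r * real k \<le> G" using r by (simp add: field_simps)
      moreover have "connected (g ` {0..1})" using cont by (intro connected_continuous_image) auto
      ultimately have "g x + 2 * r * real k \<in> g ` {0..1}"
        using connectedD_interval[of "g ` {0..1}" "g x" "g y"] assms r by (simp add: G_def)
      then show ?thesis by force
    qed
    then obtain w where w: "\<And>k. k \<le> m \<Longrightarrow> w k \<in> {0..1}" "\<And>k. k \<le> m \<Longrightarrow> g (w k) = g x + 2 * r * real k"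
      by metis
    have sep: "2 * r \<le> \<bar>g (w k) - g (w l)\<bar>" if "k \<le> m" "l \<le> m" "k \<noteq> l" for k l
    proof -
      have "1 \<le> \<bar>real k - real l\<bar>" using that(3) by linarith
      then have "2 * r * 1 \<le> 2 * r * \<bar>real k - real l\<bar>" using r by (intro mult_left_mono) auto
      also have "\<dots> = \<bar>2 * r * (real k - real l)\<bar>" using r by (simp add: abs_mult)
      finally show ?thesis using w(2) that by (simp add: algebra_simps)
    qed
    have inj: "inj_on w {..m}"
    proof (rule inj_onI, rule ccontr)
      fix k l assume "k \<in> {..m}" "l \<in> {..m}" "w k = w l" "k \<noteq> l"
      then show False using sep[of k l] r by simp
    qed
    have "card (w ` {..m}) \<le> covering_number (tree g) (tree_dist g) r"
    proof (rule tree_separated_card_le[OF r])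
      show "w ` {..m} \<subseteq> {0..1}" using w(1) by blast
      fix u v assume "u \<in> w ` {..m}" "v \<in> w ` {..m}" "u \<noteq> v"
      then obtain k l where kl: "k \<le> m" "l \<le> m" "u = w k" "v = w l" "k \<noteq> l" by auto
      have "\<bar>g u - g v\<bar> \<le> tree_pseudodist g u v"
        using tree_pseudodist_ge[OF cont, of u v u] tree_pseudodist_ge[OF cont, of u v v] w(1) kl by auto
      then show "r < tree_pseudodist g u v" using sep[of k l] kl r by simp
    qed simp
    then show ?thesis using m(2) card_image[OF inj] by simp
  qed
  show ?thesis
  proof (rule ccontr)
    assume "\<not> ?thesis"
    then have "upper_box_dim (tree g) (tree_dist g) < 1" by (simp add: not_le)
    then obtain q where q: "upper_box_dim (tree g) (tree_dist g) < ereal q" "ereal q < 1"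
      using ereal_dense2 by blast
    obtain \<epsilon> where \<epsilon>: "0 < \<epsilon>"
      "\<And>r. 0 < r \<Longrightarrow> r < \<epsilon> \<Longrightarrow> real (covering_number (tree g) (tree_dist g) r) \<le> r powr (-q)"
      using covering_number_le_of_upper_box_dim_less[OF q(1)] by blast
    have "((\<lambda>r. r powr (1 - q)) \<longlongrightarrow> 0) (at_right 0)"
      using q(2) by (intro tendsto_eq_intros tendsto_powr' refl)
        (auto intro: eventually_mono[OF eventually_at_right_less])
    then have "\<forall>\<^sub>F r in at_right 0. r powr (1 - q) < G / 2"
      using G by (intro order_tendstoD(2)) auto
    moreover have "\<forall>\<^sub>F r in at_right 0. 0 < r \<and> r < \<epsilon>"
      using eventually_at_right_real[OF \<epsilon>(1)] by (auto elim: eventually_mono)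
    ultimately have "\<forall>\<^sub>F r in at_right (0::real). False"
    proof eventually_elim
      case (elim r)
      have "G / (2 * r) \<le> r powr (-q)" using many[of r] \<epsilon>(2)[of r] elim by linarith
      then have "G / 2 \<le> r * r powr (-q)" using elim by (simp add: field_simps)
      also have "\<dots> = r powr 1 * r powr (-q)" using elim by simp
      also have "\<dots> = r powr (1 - q)" by (subst powr_add[symmetric]) simp
      finally show False using elim by simp
    qed
    then show False by simp
  qed
qed

end

section \<open>The variation index\<close>

lemma p_variation_finite:
  assumes ob: "osc_bound {0..1} g q" and q: "0 < q" "q < p"
  shows "p_variation p g < \<infinity>"
proof -
  obtain S where S: "\<And>n (t :: nat \<Rightarrow> real) a. \<lbrakk>\<And>i j. i < j \<Longrightarrow> j \<le> n \<Longrightarrow> t i < t j; \<And>i. i \<le> n \<Longrightarrow> t i \<in> {0..1};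
      \<And>i. i < n \<Longrightarrow> 0 \<le> a i \<and> (\<exists>x\<in>{t i..t (Suc i)}. \<exists>y\<in>{t i..t (Suc i)}. a i \<le> g y - g x)\<rbrakk>
      \<Longrightarrow> (\<Sum>i<n. a i powr p) \<le> S"
    using osc_bound_imp_sum_powr_bounded[OF ob q] by metis
  have "(\<Sum>i<length xs - 1. \<bar>g (xs ! i) - g (xs ! Suc i)\<bar> powr p) \<le> S"
    if xs: "sorted_wrt (<) xs" "set xs \<subseteq> {0..1}" for xs
  proof (cases "xs = []")
    case True
    show ?thesis using S[of 0 "\<lambda>_. 0"] True by simp
  next
    case False
    have less: "xs ! i < xs ! j" if "i < j" "j \<le> length xs - 1" for i j
      using xs(1) that False by (simp add: sorted_wrt_iff_nth_less)
    show ?thesis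
    proof (rule S[of "length xs - 1" "\<lambda>i. xs ! i" "\<lambda>i. \<bar>g (xs ! i) - g (xs ! Suc i)\<bar>"])
      show "xs ! i < xs ! j" if "i < j" "j \<le> length xs - 1" for i j using less that .
      show "xs ! i \<in> {0..1}" if "i \<le> length xs - 1" for i
        using subsetD[OF xs(2) nth_mem[of i xs]] that False by (cases xs) simp_all
      fix i assume i: "i < length xs - 1"
      have "xs ! i < xs ! Suc i" using less[of i "Suc i"] i by simp
      then have mem: "xs ! i \<in> {xs ! i..xs ! Suc i}" "xs ! Suc i \<in> {xs ! i..xs ! Suc i}" by auto
      show "0 \<le> \<bar>g (xs ! i) - g (xs ! Suc i)\<bar> \<and>
         (\<exists>x\<in>{xs ! i..xs ! Suc i}. \<exists>y\<in>{xs ! i..xs ! Suc i}. \<bar>g (xs ! i) - g (xs ! Suc i)\<bar> \<le> g y - g x)"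
      proof (cases "g (xs ! i) \<le> g (xs ! Suc i)")
        case True
        then show ?thesis using mem by (intro conjI bexI[of _ "xs ! i"] bexI[of _ "xs ! Suc i"]) auto
      next
        case False
        then show ?thesis using mem by (intro conjI bexI[of _ "xs ! Suc i"] bexI[of _ "xs ! i"]) auto
      qed
    qed
  qed
  then have "p_variation p g \<le> ereal S"
    unfolding p_variation_def by (intro SUP_least) auto
  also have "\<dots> < \<infinity>" by simp
  finally show ?thesis .
qed

text \<open>
  Listing all endpoints \<open>l C\<close> and \<open>u C\<close> in increasing order, \<open>u C\<close> directly follows \<open>l C\<close>: a point
  in between would lie in \<open>C\<close>, and so could not be an endpoint from another member. So each member
  contributes its own consecutive increment.
\<close>

lemma card_osc_packing_le_p_variation:
  assumes P: "osc_packing {0..1} g \<delta> \<C>" and "0 < \<delta>" "0 < p"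
  shows "ereal (real (card \<C>) * \<delta> powr p) \<le> p_variation p g"
proof -
  obtain l u where lu: "\<And>C. C \<in> \<C> \<Longrightarrow> l C \<in> C" "\<And>C. C \<in> \<C> \<Longrightarrow> u C \<in> C" "\<And>C. C \<in> \<C> \<Longrightarrow> l C < u C"
    "\<And>C. C \<in> \<C> \<Longrightarrow> \<delta> \<le> \<bar>g (l C) - g (u C)\<bar>"
    using osc_packing_endpoints[OF P \<open>0 < \<delta>\<close>] by blast
  define E where "E = l ` \<C> \<union> u ` \<C>"
  define xs where "xs = sorted_list_of_set E"
  have finE: "finite E" using P by (simp add: E_def osc_packing_def)
  then have set: "set xs = E" by (simp add: xs_def)
  have sorted: "sorted_wrt (<) xs" by (simp add: xs_def)
  then have less: "xs ! i < xs ! j" if "i < j" "j < length xs" for i j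
    using that by (simp add: sorted_wrt_iff_nth_less)
  have sub: "set xs \<subseteq> {0..1}"
    unfolding set E_def using lu(1,2) osc_packingD(1)[OF P] by blast
  have "\<exists>i. Suc i < length xs \<and> xs ! i = l C \<and> xs ! Suc i = u C" if C: "C \<in> \<C>" for C
  proof -
    have "l C \<in> set xs" "u C \<in> set xs" unfolding set E_def using C by auto
    then obtain i j where ij: "i < length xs" "xs ! i = l C" "j < length xs" "xs ! j = u C"
      unfolding in_set_conv_nth by blast
    have "i < j" using less[of j i] lu(3)[OF C] ij by (metis linorder_neqE_nat not_less_iff_gr_or_eq)
    have "Suc i = j"
    proof (rule ccontr)
      assume "Suc i \<noteq> j"
      then have "Suc i < j" using \<open>i < j\<close> by simp
      then have btw: "l C < xs ! Suc i" "xs ! Suc i < u C"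
        using less[of i "Suc i"] less[of "Suc i" j] ij by auto
      then have "xs ! Suc i \<in> C"
        using connected_real_Icc_subset[OF osc_packingD(2)[OF P C] lu(1,2)[OF C]] by (auto simp: subset_iff)
      moreover have "xs ! Suc i \<in> E" using set \<open>Suc i < j\<close> ij(3) nth_mem[of "Suc i" xs] by simp
      ultimately obtain D where "D \<in> \<C>" "xs ! Suc i = l D \<or> xs ! Suc i = u D" "xs ! Suc i \<in> C"
        unfolding E_def by blast
      moreover from this have "D = C" using osc_packing_inter[OF P _ C] lu(1,2) by metis
      ultimately show False using btw by auto
    qed
    then show ?thesis using ij by auto
  qed
  then obtain \<iota> where \<iota>: "\<And>C. C \<in> \<C> \<Longrightarrow> Suc (\<iota> C) < length xs"
    "\<And>C. C \<in> \<C> \<Longrightarrow> xs ! \<iota> C = l C" "\<And>C. C \<in> \<C> \<Longrightarrow> xs ! Suc (\<iota> C) = u C" by metis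
  have inj: "inj_on \<iota> \<C>"
    by (rule inj_onI) (metis \<iota>(2) lu(1) osc_packing_inter[OF P])
  have "real (card \<C>) * \<delta> powr p = (\<Sum>C\<in>\<C>. \<delta> powr p)" by simp
  also have "\<dots> \<le> (\<Sum>C\<in>\<C>. \<bar>g (xs ! \<iota> C) - g (xs ! Suc (\<iota> C))\<bar> powr p)"
    using \<iota> lu(4) assms(2,3) by (intro sum_mono powr_mono2) auto
  also have "\<dots> = (\<Sum>i\<in>\<iota> ` \<C>. \<bar>g (xs ! i) - g (xs ! Suc i)\<bar> powr p)"
    using inj by (simp add: sum.reindex)
  also have "\<dots> \<le> (\<Sum>i<length xs - 1. \<bar>g (xs ! i) - g (xs ! Suc i)\<bar> powr p)"
    using \<iota>(1) by (intro sum_mono2) fastforce+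
  finally have "ereal (real (card \<C>) * \<delta> powr p)
      \<le> ereal (\<Sum>i<length xs - 1. \<bar>g (xs ! i) - g (xs ! Suc i)\<bar> powr p)" by simp
  also have "\<dots> \<le> p_variation p g"
    unfolding p_variation_def using sorted sub by (intro SUP_upper) auto
  finally show ?thesis .
qed

lemma osc_bound_of_p_variation_finite:
  assumes "p_variation p g < \<infinity>" "0 < p"
  shows "osc_bound {0..1} g p"
proof -
  have le: "ereal (real (card \<C>) * \<delta> powr p) \<le> p_variation p g"
    if "osc_packing {0..1} g \<delta> \<C>" "0 < \<delta>" for \<C> \<delta>
    using card_osc_packing_le_p_variation[OF that assms(2)] .
  have "osc_packing {0..1} g 1 {}" by (simp add: osc_packing_def)
  from le[OF this] have "0 \<le> p_variation p g" by (simp add: zero_ereal_def)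
  then obtain V where V: "p_variation p g = ereal V" using assms(1) by (cases "p_variation p g") auto
  have "real (card \<C>) \<le> V * \<delta> powr (-p)" if "0 < \<delta>" "osc_packing {0..1} g \<delta> \<C>" for \<delta> \<C>
    using le[OF that(2,1)] that(1) V by (simp add: powr_minus field_simps)
  then show ?thesis unfolding osc_bound_def by blast
qed

text \<open>
  The variation index takes the supremum over \<open>p \<ge> 1\<close> only, with value 1 for the empty set, which
  agrees with the critical exponent \<open>D\<close> because \<open>D \<ge> 1\<close>.
\<close>

lemma variation_index_eq:
  assumes below: "\<And>q. 1 \<le> q \<Longrightarrow> ereal q < D \<Longrightarrow> \<not> osc_bound {0..1} g q"
    and above: "\<And>q. D < ereal q \<Longrightarrow> osc_bound {0..1} g q" and "1 \<le> D"
  shows "variation_index g = D"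
proof -
  define P where "P = {p. 1 \<le> p \<and> p_variation p g = \<infinity>}"
  have infin: "p \<in> P" if "1 \<le> p" "ereal p < D" for p
    using below[OF that] osc_bound_of_p_variation_finite[of p g] that(1) by (auto simp: P_def)
  have upper: "ereal p \<le> D" if "p \<in> P" for p
  proof (rule ccontr)
    assume "\<not> ereal p \<le> D"
    then obtain q where q: "D < ereal q" "ereal q < ereal p" by (meson ereal_dense2 not_le)
    then have "1 < ereal q" using \<open>1 \<le> D\<close> by (meson le_less_trans)
    then have "p_variation p g < \<infinity>"
      using p_variation_finite[OF above[OF q(1)], of p] q(2) by simp
    then show False using that by (simp add: P_def)
  qed
  show ?thesis
  proof (cases "P = {}")
    case True
    have "D \<le> 1"
    proof (rule ccontr)
      assume "\<not> D \<le> 1"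
      then obtain q where "1 < ereal q" "ereal q < D" by (meson ereal_dense2 not_le)
      then show False using infin[of q] True by simp
    qed
    then have "D = 1" using \<open>1 \<le> D\<close> by simp
    then show ?thesis using True by (simp add: variation_index_def P_def Let_def)
  next
    case False
    have "(SUP p\<in>P. ereal p) = D"
    proof (rule antisym)
      show "(SUP p\<in>P. ereal p) \<le> D" using upper by (intro SUP_least)
      show "D \<le> (SUP p\<in>P. ereal p)"
      proof (rule ccontr)
        assume "\<not> ?thesis"
        then obtain q where q: "(SUP p\<in>P. ereal p) < ereal q" "ereal q < D" by (meson ereal_dense2 not_le)
        obtain p where "p \<in> P" using False by blast
        then have "1 \<le> ereal p" "ereal p \<le> (SUP p\<in>P. ereal p)" by (auto simp: P_def intro: SUP_upper)
        then have "1 \<le> ereal q" using q(1) by (meson le_less_trans less_imp_le)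
        then have "q \<in> P" using infin q(2) by simp
        then have "ereal q \<le> (SUP p\<in>P. ereal p)" by (auto intro: SUP_upper)
        then show False using q(1) by simp
      qed
    qed
    then show ?thesis using False unfolding variation_index_def P_def[symmetric] Let_def by simp
  qed
qed

section \<open>Covering a graph by boxes\<close>

definition graph_on :: "(real \<Rightarrow> real) \<Rightarrow> (real \<times> real) set" where
  "graph_on h = (\<lambda>x. (x, h x)) ` {0..1}"

text \<open>
  A column of width \<open>1 / n\<close> over which \<open>h\<close> oscillates by \<open>a i\<close> meets at most \<open>n * a i + 2\<close> boxes of
  height \<open>1 / n\<close>.
\<close>

lemma graph_cover_boxes:
  assumes cont: "continuous_on {0..1} h" and n: "0 < n"
  obtains a \<U> where
    "\<And>i. i < n \<Longrightarrow> \<exists>x\<in>{real i / n..real (Suc i) / n}. \<exists>y\<in>{real i / n..real (Suc i) / n}. a i = h y - h x"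
    "\<And>i. i < n \<Longrightarrow> 0 \<le> a i"
    "r_cover (graph_on h) dist (2 / real n) \<U>"
    "real (card \<U>) \<le> real n * (\<Sum>i<n. a i) + 2 * real n"
proof -
  define J where "J i = {real i / n..real (Suc i) / n}" for i
  have J01: "J i \<subseteq> {0..1}" if "i < n" for i
  proof -
    have "0 \<le> real i / n" "real (Suc i) / n \<le> 1" using that by (auto simp: field_simps)
    then show ?thesis unfolding J_def by auto
  qed
  have J: "compact (J i)" "J i \<noteq> {}" for i
    using n by (auto simp: J_def divide_right_mono)
  have "\<forall>i\<in>{..<n}. \<exists>x\<in>J i. \<forall>w\<in>J i. h x \<le> h w"
    using continuous_attains_inf[OF J continuous_on_subset[OF cont J01]] by blast
  then obtain lo where lo: "\<And>i. i < n \<Longrightarrow> lo i \<in> J i" "\<And>i w. i < n \<Longrightarrow> w \<in> J i \<Longrightarrow> h (lo i) \<le> h w"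
    by (metis lessThan_iff)
  have "\<forall>i\<in>{..<n}. \<exists>x\<in>J i. \<forall>w\<in>J i. h w \<le> h x"
    using continuous_attains_sup[OF J continuous_on_subset[OF cont J01]] by blast
  then obtain hi where hi: "\<And>i. i < n \<Longrightarrow> hi i \<in> J i" "\<And>i w. i < n \<Longrightarrow> w \<in> J i \<Longrightarrow> h w \<le> h (hi i)"
    by (metis lessThan_iff)
  define Z where "Z = (SIGMA i:{..<n}. {\<lfloor>n * h (lo i)\<rfloor>..\<lfloor>n * h (hi i)\<rfloor>})"
  define U where "U = (\<lambda>(i, k). (\<lambda>x. (x, h x)) ` {x \<in> J i. \<lfloor>n * h x\<rfloor> = k})"
  have finZ: "finite Z" by (simp add: Z_def)
  show ?thesis
  proof (rule that[of "\<lambda>i. h (hi i) - h (lo i)" "U ` Z"])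
    show "\<exists>x\<in>{real i / n..real (Suc i) / n}. \<exists>y\<in>{real i / n..real (Suc i) / n}.
        h (hi i) - h (lo i) = h y - h x" if "i < n" for i
      using lo(1)[OF that] hi(1)[OF that] unfolding J_def by blast
    show "0 \<le> h (hi i) - h (lo i)" if "i < n" for i
      using lo(1)[OF that] hi(2)[OF that] by simp
    show "r_cover (graph_on h) dist (2 / real n) (U ` Z)"
      unfolding r_cover_def
    proof (intro conjI ballI)
      show "finite (U ` Z)" using finZ by simp
      show "graph_on h \<subseteq> \<Union> (U ` Z)"
      proof
        fix z assume "z \<in> graph_on h"
        then obtain x where x: "x \<in> {0..1}" "z = (x, h x)" by (auto simp: graph_on_def)
        have "\<exists>i<n. x \<in> J i"
        proof (cases "x = 1")
          case True
          then show ?thesis using n by (intro exI[of _ "n - 1"]) (auto simp: J_def field_simps)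
        next
          case False
          define i where "i = nat \<lfloor>n * x\<rfloor>"
          have i: "real i = real_of_int \<lfloor>n * x\<rfloor>" unfolding i_def using x(1) by simp
          have "real i \<le> n * x" "n * x < real i + 1"
            using x(1) n i by linarith+
          moreover have "n * x < n" using x False n by simp
          moreover from calculation have "i < n" by linarith
          ultimately show ?thesis using n
            by (intro exI[of _ i]) (auto simp: J_def field_simps)
        qed
        then obtain i where i: "i < n" "x \<in> J i" by blast
        have "\<lfloor>n * h (lo i)\<rfloor> \<le> \<lfloor>n * h x\<rfloor>" "\<lfloor>n * h x\<rfloor> \<le> \<lfloor>n * h (hi i)\<rfloor>"
          using lo(2)[OF i] hi(2)[OF i] by (intro floor_mono mult_left_mono; simp)+
        then have "(i, \<lfloor>n * h x\<rfloor>) \<in> Z" using i by (simp add: Z_def)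
        moreover have "z \<in> U (i, \<lfloor>n * h x\<rfloor>)" using i x by (simp add: U_def)
        ultimately show "z \<in> \<Union> (U ` Z)" by blast
      qed
      fix V assume "V \<in> U ` Z"
      then obtain i k where ik: "i < n" "V = U (i, k)" by (auto simp: Z_def)
      show "V \<subseteq> graph_on h" using J01[OF ik(1)] ik(2) by (auto simp: U_def graph_on_def)
      fix v w assume "v \<in> V" "w \<in> V"
      then obtain x y where xy: "v = (x, h x)" "w = (y, h y)" "x \<in> J i" "y \<in> J i"
        "\<lfloor>n * h x\<rfloor> = k" "\<lfloor>n * h y\<rfloor> = k" using ik(2) by (auto simp: U_def)
      have "real (Suc i) / n - real i / n = 1 / n" by (simp add: add_divide_distrib)
      then have 1: "\<bar>x - y\<bar> \<le> 1 / n" using xy(3,4) unfolding J_def by auto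
      have "\<bar>n * h x - n * h y\<bar> \<le> 1" using xy(5,6) by linarith
      then have "n * \<bar>h x - h y\<bar> \<le> 1" by (simp add: abs_mult flip: right_diff_distrib)
      then have 2: "\<bar>h x - h y\<bar> \<le> 1 / n" using n by (simp add: field_simps)
      have "dist v w \<le> \<bar>x - y\<bar> + \<bar>h x - h y\<bar>"
        unfolding xy dist_Pair_Pair dist_real_def using sqrt_sum_squares_le_sum_abs[of "\<bar>x - y\<bar>" "\<bar>h x - h y\<bar>"] by simp
      then show "dist v w \<le> 2 / n" using 1 2 by simp
    qed
    have "real (card (U ` Z)) \<le> real (card Z)" using card_image_le[OF finZ] by simp
    also have "card Z = (\<Sum>i<n. card {\<lfloor>n * h (lo i)\<rfloor>..\<lfloor>n * h (hi i)\<rfloor>})"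
      unfolding Z_def by (rule card_SigmaI) auto
    also have "real (\<Sum>i<n. card {\<lfloor>n * h (lo i)\<rfloor>..\<lfloor>n * h (hi i)\<rfloor>})
        \<le> (\<Sum>i<n. (real n * (h (hi i) - h (lo i)) + 2))"
      unfolding of_nat_sum
    proof (rule sum_mono)
      fix i assume "i \<in> {..<n}"
      then have "h (lo i) \<le> h (hi i)" using lo(1) hi(2) by simp
      then have "n * h (lo i) \<le> n * h (hi i)" by (intro mult_left_mono) auto
      then show "real (card {\<lfloor>n * h (lo i)\<rfloor>..\<lfloor>n * h (hi i)\<rfloor>}) \<le> real n * (h (hi i) - h (lo i)) + 2"
        unfolding right_diff_distrib card_atLeastAtMost_int by linarith
    qed
    also have "\<dots> = real n * (\<Sum>i<n. h (hi i) - h (lo i)) + 2 * real n"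
      by (simp add: sum.distrib sum_distrib_left mult.commute)
    finally show "real (card (U ` Z)) \<le> real n * (\<Sum>i<n. h (hi i) - h (lo i)) + 2 * real n" .
  qed
qed

lemma r_cover_mono: "r_cover X d r \<U> \<Longrightarrow> r \<le> r' \<Longrightarrow> r_cover X d r' \<U>"
  unfolding r_cover_def by (meson order_trans)

lemma graph_cover_exists:
  assumes "continuous_on {0..1} h" "0 < r"
  obtains \<U> where "r_cover (graph_on h) dist r \<U>"
proof -
  define n where "n = nat \<lceil>2 / r\<rceil>"
  have n: "2 / r \<le> real n" unfolding n_def by linarith
  then have "0 < real n" using assms(2) by (meson divide_pos_pos less_le_trans zero_less_numeral)
  then have "0 < n" "2 / real n \<le> r" using n assms(2) by (simp_all add: field_simps)
  then show ?thesis using graph_cover_boxes[OF assms(1), of n] r_cover_mono that by metis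
qed

text \<open>
  Total oscillation \<open>O(n powr s)\<close> over \<open>n\<close> columns gives \<open>O(n powr (1 + s))\<close> boxes of side \<open>1 / n\<close>.
\<close>

lemma graph_box_dim_le:
  assumes cont: "continuous_on {0..1} h" and "0 \<le> s" "0 \<le> K"
    and sum: "\<And>n a. 0 < n \<Longrightarrow> (\<And>i. i < n \<Longrightarrow> 0 \<le> a i \<and>
        (\<exists>x\<in>{real i / n..real (Suc i) / n}. \<exists>y\<in>{real i / n..real (Suc i) / n}. a i = h y - h x))
      \<Longrightarrow> (\<Sum>i<n. a i) \<le> K * real n powr s"
  shows "upper_box_dim (graph_on h) dist \<le> ereal (1 + s)"
proof -
  have le: "real (covering_number (graph_on h) dist r) \<le> ((K + 2) * 3 powr (1 + s)) * r powr (-(1 + s))"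
    if r: "0 < r" "r < 1" for r
  proof -
    define n where "n = nat \<lceil>2 / r\<rceil>"
    have "1 \<le> 1 / r" using r by simp
    moreover have "2 / r \<le> real n" "real n \<le> 2 / r + 1" unfolding n_def using r by (linarith, simp)
    ultimately have n: "2 / r \<le> real n" "real n \<le> 3 / r" "1 \<le> real n" by auto
    have "0 < n" using n(3) by simp
    obtain a \<U> where a: "\<And>i. i < n \<Longrightarrow> \<exists>x\<in>{real i / n..real (Suc i) / n}. \<exists>y\<in>{real i / n..real (Suc i) / n}. a i = h y - h x"
      "\<And>i. i < n \<Longrightarrow> 0 \<le> a i"
      and U: "r_cover (graph_on h) dist (2 / real n) \<U>" "real (card \<U>) \<le> real n * (\<Sum>i<n. a i) + 2 * real n"
      using graph_cover_boxes[OF cont \<open>0 < n\<close>] by blast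
    have "2 / real n \<le> r" using n r by (simp add: field_simps)
    then have "real (covering_number (graph_on h) dist r) \<le> real (card \<U>)"
      using covering_number_le[OF r_cover_mono[OF U(1)]] by simp
    also have "\<dots> \<le> real n * (K * real n powr s) + 2 * (real n * 1)"
      using U(2) mult_left_mono[OF sum[OF \<open>0 < n\<close>, of a], of "real n"] a by fastforce
    also have "\<dots> \<le> real n * (K * real n powr s) + 2 * (real n * real n powr s)"
      using n(3) assms(2) by (intro add_left_mono mult_left_mono ge_one_powr_ge_zero) auto
    also have "\<dots> = (K + 2) * real n powr (1 + s)"
      using n(3) by (simp add: powr_add algebra_simps)
    also have "\<dots> \<le> (K + 2) * (3 / r) powr (1 + s)"
      using n assms(2,3) by (intro mult_left_mono powr_mono2) auto
    also have "\<dots> = ((K + 2) * 3 powr (1 + s)) * r powr (-(1 + s))"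
      using r by (simp add: powr_divide powr_minus_divide del: minus_add_distrib)
    finally show ?thesis .
  qed
  have pos: "0 < covering_number (graph_on h) dist r" if "0 < r" for r
  proof -
    have "graph_on h \<noteq> {}" by (simp add: graph_on_def)
    then show ?thesis using graph_cover_exists[OF cont that] covering_number_pos by metis
  qed
  have "\<forall>\<^sub>F r in at_right 0. 0 < r \<and> r < (1::real)"
    using eventually_at_right_real[of 0 1] by (auto elim: eventually_mono)
  then show ?thesis
    by (intro upper_box_dim_le[where C = "(K + 2) * 3 powr (1 + s)"])
      (auto elim!: eventually_mono simp: pos le simp del: minus_add_distrib)
qed

lemma graph_box_dim_le_2:
  assumes cont: "continuous_on {0..1} h"
  shows "upper_box_dim (graph_on h) dist \<le> 2"
proof -
  obtain B where B: "\<And>x. x \<in> {0..1} \<Longrightarrow> \<bar>h x\<bar> \<le> B"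
    using continuous_on_compact_bound[OF _ cont] by auto
  have "upper_box_dim (graph_on h) dist \<le> ereal (1 + 1)"
  proof (rule graph_box_dim_le[OF cont])
    show "0 \<le> 2 * B" using B[of 0] by simp
    fix n :: nat and a assume "0 < n" and a: "\<And>i. i < n \<Longrightarrow> 0 \<le> a i \<and>
        (\<exists>x\<in>{real i / n..real (Suc i) / n}. \<exists>y\<in>{real i / n..real (Suc i) / n}. a i = h y - h x)"
    have "a i \<le> 2 * B" if i: "i < n" for i
    proof -
      obtain x y where xy: "x \<in> {real i / n..real (Suc i) / n}" "y \<in> {real i / n..real (Suc i) / n}" "a i = h y - h x"
        using a[OF i] by blast
      have "0 \<le> real i / n" "real (Suc i) / n \<le> 1" using i by (auto simp: field_simps)
      then have "x \<in> {0..1}" "y \<in> {0..1}" using xy unfolding atLeastAtMost_iff by (meson order_trans)+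
      then show ?thesis using B[of x] B[of y] xy(3) by linarith
    qed
    then have "(\<Sum>i<n. a i) \<le> (\<Sum>i<n. 2 * B)" by (intro sum_mono) auto
    then show "(\<Sum>i<n. a i) \<le> 2 * B * real n powr 1" by (simp add: mult.commute)
  qed simp
  then show ?thesis by simp
qed

text \<open>
  The oscillations \<open>a i\<close> over the columns have bounded \<open>p\<close>-th power sum. Their sum is then
  \<open>O(n powr (1 - 1/p))\<close>, by the elementary bound \<open>a \<le> t + t powr (1 - p) * a powr p\<close> with the threshold \<open>t\<close>
  that balances the two terms.
\<close>

lemma graph_box_dim_le_of_osc_bound:
  assumes cont: "continuous_on {0..1} h" and ob: "osc_bound {0..1} h q" and q: "0 < q" "q < p" and p: "1 \<le> p"
  shows "upper_box_dim (graph_on h) dist \<le> ereal (2 - 1 / p)"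
proof -
  obtain S where S: "\<And>n (t :: nat \<Rightarrow> real) a. \<lbrakk>\<And>i j. i < j \<Longrightarrow> j \<le> n \<Longrightarrow> t i < t j; \<And>i. i \<le> n \<Longrightarrow> t i \<in> {0..1};
      \<And>i. i < n \<Longrightarrow> 0 \<le> a i \<and> (\<exists>x\<in>{t i..t (Suc i)}. \<exists>y\<in>{t i..t (Suc i)}. a i \<le> h y - h x)\<rbrakk>
      \<Longrightarrow> (\<Sum>i<n. a i powr p) \<le> S"
    using osc_bound_imp_sum_powr_bounded[OF ob q] by metis
  have "0 \<le> S" using S[of 0 "\<lambda>_. 0"] by simp
  have "upper_box_dim (graph_on h) dist \<le> ereal (1 + (1 - 1 / p))"
  proof (rule graph_box_dim_le[OF cont, where K = "1 + S"])
    show "0 \<le> 1 - 1 / p" using p by simp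
    show "0 \<le> 1 + S" using \<open>0 \<le> S\<close> by simp
    fix n :: nat and a assume n: "0 < n" and a: "\<And>i. i < n \<Longrightarrow> 0 \<le> a i \<and>
        (\<exists>x\<in>{real i / n..real (Suc i) / n}. \<exists>y\<in>{real i / n..real (Suc i) / n}. a i = h y - h x)"
    have Sp: "(\<Sum>i<n. a i powr p) \<le> S"
    proof (rule S[of n "\<lambda>i. real i / n"])
      show "0 \<le> a i \<and> (\<exists>x\<in>{real i / n..real (Suc i) / n}. \<exists>y\<in>{real i / n..real (Suc i) / n}. a i \<le> h y - h x)"
        if "i < n" for i using a[OF that] by (metis order_refl)
    qed (use n in \<open>auto simp: field_simps\<close>)
    define t where "t = real n powr (- 1 / p)"
    have t: "0 < t" using n by (simp add: t_def)
    have "a i \<le> t + t powr (1 - p) * a i powr p" if "i < n" for i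
    proof (cases "a i \<le> t")
      case False
      then have ai: "t < a i" by simp
      have "a i = a i powr (1 - p) * a i powr p" using ai t by (simp flip: powr_add)
      also have "\<dots> \<le> t powr (1 - p) * a i powr p"
        using ai t p by (intro mult_right_mono powr_mono2') auto
      finally show ?thesis using t by simp
    qed (simp add: add_increasing2)
    then have "(\<Sum>i<n. a i) \<le> (\<Sum>i<n. t + t powr (1 - p) * a i powr p)" by (intro sum_mono) auto
    also have "\<dots> = n * t + t powr (1 - p) * (\<Sum>i<n. a i powr p)"
      by (simp add: sum.distrib sum_distrib_left)
    also have "\<dots> \<le> n * t + t powr (1 - p) * S" using Sp by (intro add_left_mono mult_left_mono) auto
    also have "t powr (1 - p) = real n powr (1 - 1 / p)"
      unfolding t_def powr_powr
      by (rule arg_cong[where f = "\<lambda>e. real n powr e"]) (use p in \<open>simp add: field_simps\<close>)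
    also have "n * t = real n powr (1 - 1 / p)"
      unfolding t_def using n by (simp add: powr_diff powr_minus_divide)
    finally show "(\<Sum>i<n. a i) \<le> (1 + S) * real n powr (1 - 1 / p)" by (simp add: algebra_simps)
  qed
  then show ?thesis by simp
qed

section \<open>A time change that makes the graph large\<close>

text \<open>
  Above each interval the intermediate value theorem gives about \<open>\<delta> / (2 * \<rho>)\<close> points of the graph whose
  heights differ by at least \<open>2 * \<rho>\<close>. A set of diameter at most \<open>\<rho>\<close> contains at most one of these
  points per interval, and it cannot meet three of the intervals, as the middle one has
  length at least \<open>\<rho>\<close>.
\<close>

lemma graph_covering_number_ge:
  assumes cont: "continuous_on {0..1} h" and fin: "finite I"
    and lu: "\<And>i. i \<in> I \<Longrightarrow> 0 \<le> l i" "\<And>i. i \<in> I \<Longrightarrow> l i + \<rho> \<le> u i" "\<And>i. i \<in> I \<Longrightarrow> u i \<le> 1"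
    and disj: "\<And>i j z. i \<in> I \<Longrightarrow> j \<in> I \<Longrightarrow> z \<in> {l i..u i} \<Longrightarrow> z \<in> {l j..u j} \<Longrightarrow> i = j"
    and osc: "\<And>i. i \<in> I \<Longrightarrow> \<delta> \<le> \<bar>h (l i) - h (u i)\<bar>" and pos: "0 < \<rho>" "0 < \<delta>"
  shows "real (card I) * (\<delta> / (2 * \<rho>)) \<le> 2 * real (covering_number (graph_on h) dist \<rho>)"
proof -
  define m where "m = nat \<lfloor>\<delta> / (2 * \<rho>)\<rfloor>"
  have m: "real m \<le> \<delta> / (2 * \<rho>)" "\<delta> / (2 * \<rho>) \<le> real m + 1"
    using pos unfolding m_def by (simp, linarith)
  define b where "b i = min (h (l i)) (h (u i))" for i
  have "\<exists>w\<in>{l i..u i}. h w = b i + 2 * \<rho> * real k" if i: "i \<in> I" and k: "k \<le> m" for i k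
  proof -
    have "real k \<le> \<delta> / (2 * \<rho>)" using m(1) k by linarith
    then have "2 * \<rho> * real k \<le> \<delta>" using pos by (simp add: field_simps)
    then have v: "b i \<le> b i + 2 * \<rho> * real k" "b i + 2 * \<rho> * real k \<le> max (h (l i)) (h (u i))"
      using osc[OF i] pos unfolding b_def by (simp, linarith)
    have "continuous_on {l i..u i} h"
      by (rule continuous_on_subset[OF cont]) (use lu i in auto)
    then have conn: "connected (h ` {l i..u i})" by (intro connected_continuous_image) auto
    have "l i \<le> u i" using lu(2)[OF i] pos by simp
    then have "h (l i) \<in> h ` {l i..u i}" "h (u i) \<in> h ` {l i..u i}" by auto
    from connected_real_Icc_subset[OF conn this] v
    have "b i + 2 * \<rho> * real k \<in> h ` {l i..u i}" unfolding b_def by (auto simp: subset_iff)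
    then show ?thesis by force
  qed
  then obtain W where W: "\<And>i k. i \<in> I \<Longrightarrow> k \<le> m \<Longrightarrow> W i k \<in> {l i..u i}"
    "\<And>i k. i \<in> I \<Longrightarrow> k \<le> m \<Longrightarrow> h (W i k) = b i + 2 * \<rho> * real k" by metis
  define p where "p = (\<lambda>(i, k). (W i k, h (W i k)))"
  define P where "P = p ` (I \<times> {..m})"
  have far: "2 * \<rho> \<le> \<bar>h (W i k) - h (W i k')\<bar>" if "i \<in> I" "k \<le> m" "k' \<le> m" "k \<noteq> k'" for i k k'
  proof -
    have "1 \<le> \<bar>real k - real k'\<bar>" using that(4) by linarith
    then have "2 * \<rho> * 1 \<le> 2 * \<rho> * \<bar>real k - real k'\<bar>" using pos by (intro mult_left_mono) auto
    also have "\<dots> = \<bar>2 * \<rho> * (real k - real k')\<bar>" using pos by (simp add: abs_mult)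
    finally show ?thesis using W(2) that by (simp add: algebra_simps)
  qed
  have inj: "inj_on p (I \<times> {..m})"
  proof (rule inj_onI, clarsimp simp: p_def)
    fix i k j k' assume *: "i \<in> I" "j \<in> I" "k \<le> m" "k' \<le> m" "W i k = W j k'"
    then have "i = j" using disj[of i j "W i k"] W(1)[of i k] W(1)[of j k'] by simp
    then show "i = j \<and> k = k'" using far[of i k k'] * pos by auto
  qed
  have "real (card I) * (\<delta> / (2 * \<rho>)) \<le> real (card I) * real (card {..m})"
    using m(2) by (intro mult_left_mono) auto
  also have "\<dots> = real (card P)"
    unfolding P_def card_image[OF inj] by (simp add: card_cartesian_product algebra_simps)
  finally have cardP: "real (card I) * (\<delta> / (2 * \<rho>)) \<le> real (card P)" .
  obtain \<U> where "r_cover (graph_on h) dist \<rho> \<U>" using graph_cover_exists[OF cont pos(1)] .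
  then have "card P \<le> 2 * covering_number (graph_on h) dist \<rho>"
  proof (rule card_le_mult_covering_number)
    show "P \<subseteq> graph_on h"
    proof
      fix z assume "z \<in> P"
      then obtain i k where ik: "i \<in> I" "k \<le> m" "z = (W i k, h (W i k))" by (auto simp: P_def p_def)
      then have "W i k \<in> {0..1}" using W(1)[OF ik(1,2)] lu(1,3)[OF ik(1)] by simp
      then show "z \<in> graph_on h" using ik(3) by (simp add: graph_on_def)
    qed
    fix U :: "(real \<times> real) set" assume U: "\<And>x y. x \<in> U \<Longrightarrow> y \<in> U \<Longrightarrow> dist x y \<le> \<rho>"
    show "card (P \<inter> U) \<le> 2"
    proof (rule ccontr)
      assume three: "\<not> ?thesis"
      define A where "A = fst ` (P \<inter> U)"
      have "finite P" using fin by (simp add: P_def)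
      then have finA: "finite A" by (simp add: A_def)
      have "inj_on fst (P \<inter> U)" by (rule inj_onI) (auto simp: P_def p_def)
      then have cardA: "3 \<le> card A" using three by (simp add: A_def card_image)
      then have ne: "A \<noteq> {}" by auto
      have "card {Min A, Max A} \<le> 2" by (simp add: card_insert_if)
      then have "\<not> A \<subseteq> {Min A, Max A}" using cardA card_mono[of "{Min A, Max A}" A] by fastforce
      then obtain c where "c \<in> A" "c \<noteq> Min A" "c \<noteq> Max A" by blast
      then have c: "c \<in> A" "Min A < c" "c < Max A"
        using Min_le[OF finA] Max_ge[OF finA] by (simp_all add: order_less_le)
      have mem: "\<exists>i k. i \<in> I \<and> k \<le> m \<and> x = W i k \<and> (W i k, h (W i k)) \<in> U" if "x \<in> A" for x
        using that unfolding A_def P_def p_def by fastforce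
      obtain i k where ik: "i \<in> I" "k \<le> m" "c = W i k" "(W i k, h (W i k)) \<in> U" using mem[OF c(1)] by blast
      have out: "x \<notin> {l i..u i}" if x: "x \<in> A" "x \<noteq> c" for x
      proof
        assume xi: "x \<in> {l i..u i}"
        obtain j k' where jk: "j \<in> I" "k' \<le> m" "x = W j k'" "(W j k', h (W j k')) \<in> U" using mem[OF x(1)] by blast
        then have "j = i" using disj[of j i x] W(1)[of j k'] ik(1) xi by simp
        moreover have "\<bar>h (W i k) - h (W j k')\<bar> \<le> \<rho>"
          using U[OF ik(4) jk(4)] dist_snd_le[of "(W i k, h (W i k))" "(W j k', h (W j k'))"]
          by (simp add: dist_real_def)
        ultimately have "k = k'" using far[of i k k'] ik(1,2) jk(2) pos by fastforce
        then show False using x(2) ik(3) jk(3) \<open>j = i\<close> by simp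
      qed
      have ci: "c \<in> {l i..u i}" using W(1)[OF ik(1,2)] ik(3) by simp
      have "Min A < l i" "u i < Max A"
        using out[OF Min_in[OF finA ne]] out[OF Max_in[OF finA ne]] c ci by auto
      then have "\<rho> < Max A - Min A" using lu(2)[OF ik(1)] by linarith
      moreover obtain x y where "(Min A, x) \<in> U" "(Max A, y) \<in> U"
        using mem[OF Min_in[OF finA ne]] mem[OF Max_in[OF finA ne]] by metis
      then have "\<bar>Min A - Max A\<bar> \<le> \<rho>"
        using U[of "(Min A, x)" "(Max A, y)"] dist_fst_le[of "(Min A, x)" "(Max A, y)"]
        by (simp add: dist_real_def)
      ultimately show False by linarith
    qed
  qed
  then show ?thesis using cardP by linarith
qed

text \<open>
  \<open>F\<close> is the distribution function of a mixture of the uniform distribution with weight \<open>1/2\<close>, which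
  makes it strictly increasing, and of the distributions \<open>\<phi> j\<close> with weights \<open>(1/2)^(j + 2)\<close>, which sum
  to \<open>1/2\<close>. It stretches every interval to at least the weighted mass that \<open>\<phi> j\<close> gives it.
\<close>

lemma mixed_time_change:
  fixes \<phi> :: "nat \<Rightarrow> real \<Rightarrow> real"
  assumes cont: "\<And>j. continuous_on {0..1} (\<phi> j)"
    and mono: "\<And>j x y. 0 \<le> x \<Longrightarrow> x \<le> y \<Longrightarrow> y \<le> 1 \<Longrightarrow> \<phi> j x \<le> \<phi> j y"
    and ends: "\<And>j. \<phi> j 0 = 0" "\<And>j. \<phi> j 1 = 1"
  obtains F G where "homeomorphism {0..1} {0..1} F G" "F 0 = 0" "F 1 = 1"
    "\<And>x y. x \<in> {0..1} \<Longrightarrow> y \<in> {0..1} \<Longrightarrow> F x \<le> F y \<longleftrightarrow> x \<le> y"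
    "\<And>j x y. 0 \<le> x \<Longrightarrow> x \<le> y \<Longrightarrow> y \<le> 1 \<Longrightarrow> (1/2) ^ (j + 2) * (\<phi> j y - \<phi> j x) \<le> F y - F x"
proof -
  let ?w = "\<lambda>j. (1/2 :: real) ^ (j + 2)"
  define F where "F x = x / 2 + (\<Sum>j. ?w j * \<phi> j x)" for x
  have "(\<lambda>j. (1/2 :: real) ^ Suc j * (1/2)) sums (1 * (1/2))"
    by (rule sums_mult2[OF power_half_series])
  then have w: "?w sums (1/2)" by (simp add: mult.commute)
  have \<phi>01: "\<phi> j x \<in> {0..1}" if "x \<in> {0..1}" for j x
    using mono[of 0 x j] mono[of x 1 j] ends that by simp
  have bd: "norm (?w j * \<phi> j x) \<le> ?w j" if "x \<in> {0..1}" for j x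
    using \<phi>01[OF that, of j] by (simp add: abs_mult mult_left_le)
  have sm: "summable (\<lambda>j. ?w j * \<phi> j x)" if "x \<in> {0..1}" for x
    by (rule summable_comparison_test'[OF sums_summable[OF w]]) (use bd[OF that] in blast)
  have unif: "uniform_limit {0..1} (\<lambda>n x. \<Sum>j<n. ?w j * \<phi> j x) (\<lambda>x. \<Sum>j. ?w j * \<phi> j x) sequentially"
    by (rule Weierstrass_m_test[OF bd sums_summable[OF w]])
  have contF: "continuous_on {0..1} F"
    unfolding F_def
    by (intro continuous_intros uniform_limit_theorem[OF _ unif] always_eventually allI cont) simp_all
  have F0: "F 0 = 0" by (simp add: F_def ends)
  have F1: "F 1 = 1" using sums_unique[OF w] by (simp add: F_def ends)
  have diff: "(y - x) / 2 + ?w j * (\<phi> j y - \<phi> j x) \<le> F y - F x"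
    if xy: "0 \<le> x" "x \<le> y" "y \<le> 1" for j x y
  proof -
    have s: "summable (\<lambda>j. ?w j * \<phi> j x)" "summable (\<lambda>j. ?w j * \<phi> j y)" using sm xy by simp_all
    have "?w j * \<phi> j y - ?w j * \<phi> j x = (\<Sum>i\<in>{j}. ?w i * \<phi> i y - ?w i * \<phi> i x)" by simp
    also have "\<dots> \<le> (\<Sum>i. ?w i * \<phi> i y - ?w i * \<phi> i x)"
      using mono[OF xy] by (intro sum_le_suminf summable_diff s) (auto intro: mult_left_mono)
    also have "\<dots> = (\<Sum>i. ?w i * \<phi> i y) - (\<Sum>i. ?w i * \<phi> i x)" by (rule suminf_diff[OF s(2,1), symmetric])
    finally show ?thesis by (simp add: F_def algebra_simps diff_divide_distrib)
  qed
  have le: "?w j * (\<phi> j y - \<phi> j x) \<le> F y - F x" if "0 \<le> x" "x \<le> y" "y \<le> 1" for j x y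
    by (rule order_trans[OF _ diff[OF that, of j]]) (use that in simp)
  have less: "F x < F y" if "0 \<le> x" "x < y" "y \<le> 1" for x y
  proof -
    have "0 \<le> ?w 0 * (\<phi> 0 y - \<phi> 0 x)" using mono[of x y 0] that by simp
    then have "(y - x) / 2 \<le> (y - x) / 2 + ?w 0 * (\<phi> 0 y - \<phi> 0 x)" by simp
    also have "\<dots> \<le> F y - F x" using that by (intro diff) auto
    finally show ?thesis using that by simp
  qed
  have iff: "F x \<le> F y \<longleftrightarrow> x \<le> y" if "x \<in> {0..1}" "y \<in> {0..1}" for x y
    using less[of x y] less[of y x] that by (cases x y rule: linorder_cases) auto
  have inj: "inj_on F {0..1}" by (rule inj_onI) (metis iff order_antisym order_refl)
  have im: "F ` {0..1} = {0..1}"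
  proof
    show "F ` {0..1} \<subseteq> {0..1}"
      using iff[of 0] iff[of _ 1] F0 F1 by auto
    have "connected (F ` {0..1})" using contF by (intro connected_continuous_image) auto
    moreover have "0 \<in> F ` {0..1}" "1 \<in> F ` {0..1}"
      using F0 F1 by (metis atLeastAtMost_iff imageI order_refl zero_le_one)+
    ultimately show "{0..1} \<subseteq> F ` {0..1}" using connected_contains_Icc by blast
  qed
  obtain G where "homeomorphism {0..1} {0..1} F G"
    using homeomorphism_compact[OF _ contF im inj] by auto
  then show ?thesis using that[of F G] F0 F1 iff le by blast
qed

text \<open>
  The failure of the bound with exponent \<open>q j\<close>, for arbitrarily large constants, gives packings with
  \<open>M j \<ge> \<delta> j powr (- q j)\<close> members and with \<open>M j\<close> as large as desired. The distribution \<open>\<phi> j\<close>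
  spreads its mass equally over the members, uniformly between two points \<open>l\<close> and \<open>u\<close> of large
  oscillation in each.

  With \<open>c j = (1/2)^(j + 2)\<close> and \<open>\<rho> j = c j / M j\<close> the covering number at scale \<open>\<rho> j\<close> is at
  least \<open>M j * (\<delta> j / (4 * \<rho> j)) \<ge> M j * (M j * \<delta> j) \<ge> M j powr (2 - 1 / q j)\<close>. The
  requirement \<open>M j \<ge> (1 / c j)^(j + 1)\<close> makes \<open>1 / \<rho> j\<close> at most \<open>M j\<close> to the power
  \<open>(j + 2) / (j + 1)\<close>, so the exponent relative to \<open>1 / \<rho> j\<close> is at least
  \<open>(2 - 1 / q j) * (j + 1) / (j + 2)\<close>, which tends to \<open>2 - s\<close>.
\<close>

lemma time_change_graph_large:
  fixes h :: "real \<Rightarrow> real" and q :: "nat \<Rightarrow> real"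
  assumes cont: "continuous_on {0..1} h" and q: "\<And>j. 1/2 \<le> q j" "\<And>j. \<not> osc_bound {0..1} h (q j)"
    and lim: "(\<lambda>j. 1 / q j) \<longlonglongrightarrow> s"
  obtains F G where "homeomorphism {0..1} {0..1} F G" "F 0 = 0" "F 1 = 1"
    "ereal (2 - s) \<le> upper_box_dim (graph_on (h \<circ> G)) dist"
proof -
  obtain B where B: "\<And>x. x \<in> {0..1} \<Longrightarrow> \<bar>h x\<bar> \<le> B"
    using continuous_on_compact_bound[OF _ cont] by auto
  have "\<exists>\<delta> \<C>. 0 < \<delta> \<and> osc_packing {0..1} h \<delta> \<C> \<and> \<delta> powr (- q j) \<le> real (card \<C>) \<and>
      2 ^ ((j + 2) * (j + 1)) \<le> real (card \<C>)" for j
  proof -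
    let ?N = "2 ^ ((j + 2) * (j + 1)) :: real"
    \<comment> \<open>The first summand of the constant gives \<open>card \<C> \<ge> \<delta> powr (- q j)\<close>, the second
      \<open>card \<C> \<ge> ?N\<close>, because \<open>\<delta> \<le> 2 * B\<close>.\<close>
    have "\<not> (\<forall>\<delta>>0. \<forall>\<C>. osc_packing {0..1} h \<delta> \<C> \<longrightarrow>
        real (card \<C>) \<le> (1 + ?N * (2 * B) powr q j) * \<delta> powr (- q j))"
      using q(2)[of j] unfolding osc_bound_def by blast
    then obtain \<delta> \<C> where d: "0 < \<delta>" and P: "osc_packing {0..1} h \<delta> \<C>"
      and big: "(1 + ?N * (2 * B) powr q j) * \<delta> powr (- q j) < real (card \<C>)"
      by (auto simp: not_le)
    have "0 \<le> (1 + ?N * (2 * B) powr q j) * \<delta> powr (- q j)" by simp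
    then have "0 < real (card \<C>)" using big by linarith
    then have "\<C> \<noteq> {}" by auto
    have one: "1 \<le> (2 * B) powr q j * \<delta> powr (- q j)"
      using powr_mult_minus_ge_1[OF d osc_packing_delta_le[OF P \<open>\<C> \<noteq> {}\<close> B]] q(1)[of j] by simp
    have split: "(1 + ?N * (2 * B) powr q j) * \<delta> powr (- q j)
        = \<delta> powr (- q j) + ?N * ((2 * B) powr q j * \<delta> powr (- q j))"
      by (simp add: algebra_simps)
    have "?N * 1 \<le> ?N * ((2 * B) powr q j * \<delta> powr (- q j))" using one by (intro mult_left_mono) auto
    then have "?N \<le> real (card \<C>)" using big split powr_ge_zero[of \<delta> "- q j"] by linarith
    moreover have "0 \<le> ?N * ((2 * B) powr q j * \<delta> powr (- q j))" by simp
    then have "\<delta> powr (- q j) \<le> real (card \<C>)" using big split by linarith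
    ultimately show ?thesis using d P by blast
  qed
  then obtain \<delta> \<C> where d: "\<And>j. 0 < \<delta> j" and P: "\<And>j. osc_packing {0..1} h (\<delta> j) (\<C> j)"
    and many: "\<And>j. \<delta> j powr (- q j) \<le> real (card (\<C> j))" "\<And>j. 2 ^ ((j + 2) * (j + 1)) \<le> real (card (\<C> j))"
    by metis
  have "\<forall>j. \<exists>l u. \<forall>C\<in>\<C> j. l C \<in> C \<and> u C \<in> C \<and> l C < u C \<and> \<delta> j \<le> \<bar>h (l C) - h (u C)\<bar>"
    using osc_packing_endpoints[OF P d] by metis
  then obtain l u where lu: "\<And>j C. C \<in> \<C> j \<Longrightarrow> l j C \<in> C" "\<And>j C. C \<in> \<C> j \<Longrightarrow> u j C \<in> C"
    "\<And>j C. C \<in> \<C> j \<Longrightarrow> l j C < u j C" "\<And>j C. C \<in> \<C> j \<Longrightarrow> \<delta> j \<le> \<bar>h (l j C) - h (u j C)\<bar>"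
    by metis
  have lu01: "0 \<le> l j C" "u j C \<le> 1" if "C \<in> \<C> j" for j C
    using lu(1,2)[OF that] osc_packingD(1)[OF P that] by auto
  define M where "M j = real (card (\<C> j))" for j
  have M1: "1 \<le> M j" for j
  proof -
    have "(1::real) \<le> 2 ^ ((j + 2) * (j + 1))" by (rule one_le_power) simp
    then show ?thesis using many(2)[of j] unfolding M_def by linarith
  qed
  define ramp where "ramp j C x = max 0 (min 1 ((x - l j C) / (u j C - l j C)))" for j C x
  define \<phi> where "\<phi> j x = (\<Sum>C\<in>\<C> j. ramp j C x) / M j" for j x
  have ramp_mono: "ramp j C x \<le> ramp j C y" if "C \<in> \<C> j" "x \<le> y" for j C x y
    unfolding ramp_def using lu(3)[OF that(1)] that(2)
    by (intro max.mono min.mono divide_right_mono order_refl) auto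
  have ramp_l: "ramp j C x = 0" if "C \<in> \<C> j" "x \<le> l j C" for j C x
    unfolding ramp_def using lu(3)[OF that(1)] that(2) by (simp add: divide_nonpos_pos min.coboundedI2)
  have ramp_u: "ramp j C x = 1" if "C \<in> \<C> j" "u j C \<le> x" for j C x
    unfolding ramp_def using lu(3)[OF that(1)] that(2) by (simp add: min_absorb1)
  obtain F G where FG: "homeomorphism {0..1} {0..1} F G" "F 0 = 0" "F 1 = 1"
    and F: "\<And>x y. x \<in> {0..1} \<Longrightarrow> y \<in> {0..1} \<Longrightarrow> F x \<le> F y \<longleftrightarrow> x \<le> y"
      "\<And>j x y. 0 \<le> x \<Longrightarrow> x \<le> y \<Longrightarrow> y \<le> 1 \<Longrightarrow> (1/2) ^ (j + 2) * (\<phi> j y - \<phi> j x) \<le> F y - F x"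
  proof (rule mixed_time_change[of \<phi>])
    show "continuous_on {0..1} (\<phi> j)" for j
      unfolding \<phi>_def ramp_def using M1[of j] lu(3)[of _ j]
      by (intro continuous_intros) force+
    show "\<phi> j x \<le> \<phi> j y" if "x \<le> y" for j x y
      unfolding \<phi>_def using M1[of j] ramp_mono that by (intro divide_right_mono sum_mono) auto
    show "\<phi> j 0 = 0" for j
      unfolding \<phi>_def using ramp_l lu01 by simp
    have "(\<Sum>C\<in>\<C> j. ramp j C 1) = M j" for j
      using ramp_u lu01 by (simp add: M_def)
    then show "\<phi> j 1 = 1" for j
      unfolding \<phi>_def using M1[of j] by simp
  qed blast
  have hm: "\<And>x. x \<in> {0..1} \<Longrightarrow> G (F x) = x" "\<And>x. x \<in> {0..1} \<Longrightarrow> F (G x) = x"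
    "F ` {0..1} = {0..1}" "G ` {0..1} = {0..1}" "continuous_on {0..1} G"
    using FG(1) unfolding homeomorphism_def by auto
  have conthG: "continuous_on {0..1} (h \<circ> G)"
    by (rule continuous_on_compose) (use hm cont in auto)
  define c where "c j = (1/2 :: real) ^ (j + 2)" for j :: nat
  define \<rho> where "\<rho> j = c j / M j" for j
  have c: "0 < c j" "c j \<le> 1/4" for j
    using power_decreasing[of 2 "j + 2" "1/2 :: real"] by (auto simp: c_def power2_eq_square)
  have \<rho>: "0 < \<rho> j" "\<rho> j \<le> c j" for j
    using c[of j] M1[of j] by (auto simp: \<rho>_def field_simps mult_left_le)
  have long: "F (l j C) + \<rho> j \<le> F (u j C)" if C: "C \<in> \<C> j" for j C
  proof -
    have fin: "finite (\<C> j)" using P[of j] by (simp add: osc_packing_def)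
    have "1 = (\<Sum>D\<in>{C}. ramp j D (u j C) - ramp j D (l j C))" using ramp_l ramp_u C by simp
    also have "\<dots> \<le> (\<Sum>D\<in>\<C> j. ramp j D (u j C) - ramp j D (l j C))"
      using ramp_mono lu(3)[OF C] C fin by (intro sum_mono2) auto
    finally have "1 / M j \<le> \<phi> j (u j C) - \<phi> j (l j C)"
      unfolding \<phi>_def using M1[of j] by (simp add: sum_subtractf divide_right_mono flip: diff_divide_distrib)
    then have "c j * (1 / M j) \<le> c j * (\<phi> j (u j C) - \<phi> j (l j C))"
      using c[of j] by (intro mult_left_mono) auto
    also have "\<dots> \<le> F (u j C) - F (l j C)"
      unfolding c_def using F(2) lu01[OF C] lu(3)[OF C] by simp
    finally show ?thesis by (simp add: \<rho>_def)
  qed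
  have large: "M j powr (2 - 1 / q j) \<le> real (covering_number (graph_on (h \<circ> G)) dist (\<rho> j))" for j
  proof -
    have "real (card (\<C> j)) * (\<delta> j / (2 * \<rho> j)) \<le> 2 * real (covering_number (graph_on (h \<circ> G)) dist (\<rho> j))"
    proof (rule graph_covering_number_ge[where l = "\<lambda>C. F (l j C)" and u = "\<lambda>C. F (u j C)", OF conthG])
      show "finite (\<C> j)" using P[of j] by (simp add: osc_packing_def)
      fix C assume C: "C \<in> \<C> j"
      have mem: "l j C \<in> {0..1}" "u j C \<in> {0..1}" using lu01[OF C] lu(3)[OF C] by auto
      show "0 \<le> F (l j C)" using F(1)[of 0 "l j C"] mem FG(2) by simp
      show "F (u j C) \<le> 1" using F(1)[of "u j C" 1] mem FG(3) by simp
      show "F (l j C) + \<rho> j \<le> F (u j C)" using long[OF C] .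
      show "\<delta> j \<le> \<bar>(h \<circ> G) (F (l j C)) - (h \<circ> G) (F (u j C))\<bar>" using lu(4)[OF C] hm(1) mem by simp
    next
      \<comment> \<open>The stretched intervals pull back into the members of the packing, hence are disjoint.\<close>
      have pull: "G z \<in> C" if C: "C \<in> \<C> j" and z: "z \<in> {F (l j C)..F (u j C)}" for C z
      proof -
        have mem: "l j C \<in> {0..1}" "u j C \<in> {0..1}" using lu01[OF C] lu(3)[OF C] by auto
        then have "z \<in> {0..1}" using F(1)[of 0 "l j C"] F(1)[of "u j C" 1] FG(2,3) z by auto
        then have "G z \<in> {0..1}" "F (G z) = z" using hm(2,4) by auto
        then have "G z \<in> {l j C..u j C}" using F(1)[of "l j C" "G z"] F(1)[of "G z" "u j C"] mem z by simp
        then show ?thesis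
          using connected_real_Icc_subset[OF osc_packingD(2)[OF P C] lu(1,2)[OF C]] by (auto simp: subset_iff)
      qed
      fix C D z assume "C \<in> \<C> j" "D \<in> \<C> j" "z \<in> {F (l j C)..F (u j C)}" "z \<in> {F (l j D)..F (u j D)}"
      then show "C = D" using pull osc_packing_inter[OF P] by metis
    qed (use \<rho> d in auto)
    then have "M j * (\<delta> j / (4 * \<rho> j)) \<le> real (covering_number (graph_on (h \<circ> G)) dist (\<rho> j))"
      by (simp add: M_def)
    moreover have "M j * (M j * \<delta> j) \<le> M j * (\<delta> j / (4 * \<rho> j))"
    proof (rule mult_left_mono)
      have "4 * \<rho> j * M j \<le> 1" using c[of j] M1[of j] by (simp add: \<rho>_def)
      then have "4 * \<rho> j * M j * \<delta> j \<le> 1 * \<delta> j" using d[of j] by (intro mult_right_mono) auto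
      then show "M j * \<delta> j \<le> \<delta> j / (4 * \<rho> j)" using \<rho>(1)[of j] by (simp add: field_simps)
    qed (use M1[of j] in simp)
    moreover have "M j powr (2 - 1 / q j) \<le> M j * (M j * \<delta> j)"
    proof -
      have q0: "0 < q j" using q(1)[of j] by linarith
      have "(\<delta> j powr (- q j)) powr (1 / q j) \<le> M j powr (1 / q j)"
        using many(1)[of j] q0 by (intro powr_mono2) (auto simp: M_def)
      moreover have "(\<delta> j powr (- q j)) powr (1 / q j) = \<delta> j powr (-1)"
        unfolding powr_powr using q0 by simp
      then have "(\<delta> j powr (- q j)) powr (1 / q j) = 1 / \<delta> j" using d[of j] by (simp add: powr_minus_divide)
      ultimately have "1 / \<delta> j \<le> M j powr (1 / q j)" by simp
      then have "1 \<le> M j powr (1 / q j) * \<delta> j" using d[of j] by (simp add: field_simps)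
      then have "M j powr (2 - 1 / q j) * 1 \<le> M j powr (2 - 1 / q j) * (M j powr (1 / q j) * \<delta> j)"
        by (intro mult_left_mono) auto
      also have "\<dots> = (M j powr (2 - 1 / q j) * M j powr (1 / q j)) * \<delta> j" by (simp only: mult.assoc)
      also have "M j powr (2 - 1 / q j) * M j powr (1 / q j) = M j powr 2"
        by (subst powr_add[symmetric]) simp
      also have "M j powr 2 * \<delta> j = M j * (M j * \<delta> j)" using M1[of j] by (simp add: power2_eq_square)
      finally show ?thesis by simp
    qed
    ultimately show ?thesis by linarith
  qed
  define s' where "s' j = (2 - 1 / q j) * (real (j + 1) / real (j + 2))" for j
  have rate: "\<rho> j powr (- s' j) \<le> M j powr (2 - 1 / q j)" for j
  proof -
    have q2: "0 \<le> 2 - 1 / q j" using q(1)[of j] by (simp add: field_simps)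
    have cM: "1 / c j \<le> M j powr (1 / real (j + 1))"
    proof -
      have "1 / c j = 2 ^ (j + 2)" by (simp add: c_def power_one_over)
      also have "\<dots> = 2 powr real (j + 2)" by (rule powr_realpow[symmetric]) simp
      also have "\<dots> = (2 powr real ((j + 2) * (j + 1))) powr (1 / real (j + 1))"
        unfolding powr_powr of_nat_mult by simp
      also have "\<dots> \<le> M j powr (1 / real (j + 1))"
      proof (rule powr_mono2)
        have "2 powr real ((j + 2) * (j + 1)) = 2 ^ ((j + 2) * (j + 1))" by (rule powr_realpow) simp
        then show "2 powr real ((j + 2) * (j + 1)) \<le> M j" using many(2)[of j] unfolding M_def by simp
      qed auto
      finally show ?thesis .
    qed
    have "1 / \<rho> j = M j * (1 / c j)" by (simp add: \<rho>_def)
    also have "\<dots> \<le> M j powr 1 * M j powr (1 / real (j + 1))"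
      using mult_left_mono[OF cM, of "M j"] M1[of j] by simp
    also have "\<dots> = M j powr (real (j + 2) / real (j + 1))"
      by (subst powr_add[symmetric]) (simp add: field_simps)
    finally have "(1 / \<rho> j) powr s' j \<le> (M j powr (real (j + 2) / real (j + 1))) powr s' j"
      using q2 \<rho>(1)[of j] by (intro powr_mono2) (auto simp: s'_def)
    also have "\<dots> = M j powr (2 - 1 / q j)"
      unfolding powr_powr s'_def by (rule arg_cong[where f = "\<lambda>e. M j powr e"]) simp
    finally show ?thesis using \<rho>(1)[of j] by (simp add: powr_divide powr_minus_divide)
  qed
  have "ereal (2 - s) \<le> upper_box_dim (graph_on (h \<circ> G)) dist"
  proof (rule upper_box_dim_ge_of_seq)
    have "c \<longlonglongrightarrow> 0"
      unfolding c_def by (intro LIMSEQ_ignore_initial_segment[OF LIMSEQ_realpow_zero]) auto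
    then show "\<rho> \<longlonglongrightarrow> 0"
      using \<rho> by (intro tendsto_sandwich[of "\<lambda>_. 0" \<rho> sequentially c])
        (auto intro!: always_eventually simp: less_imp_le)
    show "0 < \<rho> j" "\<rho> j < 1" for j using \<rho>[of j] c[of j] by linarith+
    have "(\<lambda>j. real (j + 1) / real (j + 2)) \<longlonglongrightarrow> 1"
    proof -
      have "(\<lambda>j. 1 - 1 / real (j + 2)) \<longlonglongrightarrow> 1 - 0"
        by (intro tendsto_intros LIMSEQ_ignore_initial_segment[OF lim_1_over_n])
      moreover have "(\<lambda>j. real (j + 1) / real (j + 2)) = (\<lambda>j. 1 - 1 / real (j + 2))"
        by (simp add: fun_eq_iff field_simps)
      ultimately show ?thesis by simp
    qed
    then have "s' \<longlonglongrightarrow> (2 - s) * 1" unfolding s'_def by (intro tendsto_intros lim)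
    then show "s' \<longlonglongrightarrow> 2 - s" by simp
    show "\<rho> j powr (- s' j) \<le> real (covering_number (graph_on (h \<circ> G)) dist (\<rho> j))" for j
      using rate[of j] large[of j] by linarith
  qed
  then show ?thesis using that FG by blast
qed

text \<open>
  A map that fixes both endpoints respects the identification of \<open>0\<close> with \<open>1\<close> and so passes to the
  quotient.
\<close>

lemma circle_lift:
  assumes cont: "continuous_on {0..1} \<phi>" and im: "\<phi> ` {0..1} = {0..1}" and ends: "\<phi> 0 = 0" "\<phi> 1 = 1"
  obtains k where "continuous_on circle k" "k ` circle \<subseteq> circle" "\<And>x. x \<in> {0..1} \<Longrightarrow> k (circle_pt x) = circle_pt (\<phi> x)"
proof -
  have "continuous_on {0..1} (\<lambda>x. circle_pt (\<phi> x))"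
    by (rule continuous_on_compose2[OF continuous_on_circle_pt[of UNIV] cont]) simp
  then have map: "continuous_map (top_of_set {0..1}) (top_of_set circle) (\<lambda>x. circle_pt (\<phi> x))"
    using circle_pt_in_circle by (auto simp: continuous_map_in_subtopology)
  have "circle_pt (\<phi> x) = circle_pt (\<phi> y)"
    if "x \<in> topspace (top_of_set {0..1})" "y \<in> topspace (top_of_set {0..1})" "circle_pt x = circle_pt y" for x y
    using that circle_pt_eq_iff[of x y] circle_pt_eq_iff[of 0 1] ends by auto
  note lift = quotient_map_lift_exists[OF quotient_map_circle_pt map this]
  show ?thesis
  proof (rule lift)
    fix k assume k: "continuous_map (top_of_set circle) (top_of_set circle) k"
      "\<And>x. x \<in> topspace (top_of_set {0..1}) \<Longrightarrow> k (circle_pt x) = circle_pt (\<phi> x)"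
    show thesis
    proof (rule that)
      show "continuous_on circle k" "k ` circle \<subseteq> circle"
        using k(1) by (auto simp: continuous_map_in_subtopology)
      show "k (circle_pt x) = circle_pt (\<phi> x)" if "x \<in> {0..1}" for x
        using k(2) that by simp
    qed
  qed
qed

lemma circle_homeo_of_interval_homeo:
  assumes hom: "homeomorphism {0..1} {0..1} F G" and ends: "F 0 = 0" "F 1 = 1"
  obtains \<tau> where "\<tau> \<in> circle_homeos" "\<And>x. x \<in> {0..1} \<Longrightarrow> \<tau> (circle_pt x) = circle_pt (G x)"
proof -
  have hm: "\<And>x. x \<in> {0..1} \<Longrightarrow> G (F x) = x" "\<And>x. x \<in> {0..1} \<Longrightarrow> F (G x) = x"
    "F ` {0..1} = {0..1}" "G ` {0..1} = {0..1}" "continuous_on {0..1} F" "continuous_on {0..1} G"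
    using hom unfolding homeomorphism_def by auto
  have G01: "G 0 = 0" "G 1 = 1" using hm(1)[of 0] hm(1)[of 1] ends by simp_all
  obtain k where k: "continuous_on circle k" "k ` circle \<subseteq> circle"
    "\<And>x. x \<in> {0..1} \<Longrightarrow> k (circle_pt x) = circle_pt (F x)"
    using circle_lift[OF hm(5,3) ends] by blast
  obtain \<tau> where t: "continuous_on circle \<tau>" "\<tau> ` circle \<subseteq> circle"
    "\<And>x. x \<in> {0..1} \<Longrightarrow> \<tau> (circle_pt x) = circle_pt (G x)"
    using circle_lift[OF hm(6,4) G01] by blast
  have "homeomorphism circle circle \<tau> k"
  proof (rule homeomorphismI)
    fix z assume "z \<in> circle"
    then have z: "z = circle_pt (circle_angle z)" by (simp add: circle_pt_circle_angle)
    have "G (circle_angle z) \<in> {0..1}" "F (circle_angle z) \<in> {0..1}"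
      using hm(3,4) circle_angle_in by blast+
    then show "k (\<tau> z) = z" "\<tau> (k z) = z"
      using k(3) t(3) hm(1,2) circle_angle_in z by metis+
  qed (use k t in auto)
  then show ?thesis using that[of \<tau>] t(3) unfolding circle_homeos_def by blast
qed

section \<open>The optimal graph dimension\<close>

lemma graph_dim_comp:
  assumes "\<And>x. x \<in> {0..1} \<Longrightarrow> h x = f (\<tau> (circle_pt x))"
  shows "graph_dim (f \<circ> \<tau>) = upper_box_dim (graph_on h) dist"
  unfolding graph_dim_def graph_def graph_on_def using image_cong[OF refl, of "{0..1}" "\<lambda>x. (x, (f \<circ> \<tau>) (circle_pt x))" "\<lambda>x. (x, h x)"] assms by simp

theorem theorem5p3:
  fixes f :: "complex \<Rightarrow> real"
  assumes cont: "continuous_on circle f"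
    and nonconst: "\<not> f constant_on circle"
  shows "(\<exists>\<tau>'\<in>circle_homeos.
            graph_dim (f \<circ> \<tau>') = 2 - 1 / tree_dim f \<and>
            2 - 1 / tree_dim f = 2 - 1 / variation_index (excursion_of f)) \<and>
         (\<forall>\<tau>\<in>circle_homeos. 1 / (2 - graph_dim (f \<circ> \<tau>)) \<le> tree_dim f) \<and>
         is_maximum (tree_dim f) ((\<lambda>\<kappa>. 1 / (2 - graph_dim (f \<circ> \<kappa>))) ` circle_homeos)"
proof -
  define D where "D = tree_dim f"
  define g where "g = excursion_of f"
  define a where "a = arg_min_on f circle"
  have gcont: "continuous_on {0..1} g"
    using excursion_excursion_of[OF cont] by (simp add: excursion_def g_def)
  have g: "g x = f (a * circle_pt x) - f a" for x by (simp add: g_def excursion_of_def a_def Let_def)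
  have "circle \<noteq> {}" by (simp add: circle_def)
  then obtain b where "b \<in> circle" "\<forall>z\<in>circle. f b \<le> f z"
    using continuous_attains_inf[OF _ _ cont] by (auto simp: circle_def)
  then have "is_arg_min f (\<lambda>x. x \<in> circle) b" by (auto simp: is_arg_min_linorder)
  then have "is_arg_min f (\<lambda>x. x \<in> circle) a"
    unfolding a_def arg_min_on_def arg_min_def by (rule someI)
  then have a: "a \<in> circle" by (auto simp: is_arg_min_linorder)
  then have a0: "cmod a = 1" "a \<noteq> 0" by (auto simp: circle_def)
  have rot: "homeomorphism circle circle (\<lambda>z. a * z) (\<lambda>z. z / a)"
    by (rule homeomorphismI) (use a0 in \<open>auto intro!: continuous_intros simp: circle_def norm_mult norm_divide\<close>)
  have bound_g: "osc_bound {0..1} g q \<longleftrightarrow> osc_bound circle f q" if "0 \<le> q" for q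
    by (rule osc_bound_circle_iff[OF rot cont _ that, of _ "- f a"]) (simp add: g)
  have D: "D = upper_box_dim (tree g) (tree_dist g)" by (simp add: D_def tree_dim_def g_def)
  have D1: "1 \<le> D"
  proof -
    have onto: "\<exists>x\<in>{0..1}. z = a * circle_pt x" if "z \<in> circle" for z
    proof -
      have "z / a \<in> circle" using rot that unfolding homeomorphism_def by blast
      then show ?thesis
        using circle_pt_circle_angle[of "z / a"] circle_angle_in a0 by (intro bexI[of _ "circle_angle (z / a)"]) auto
    qed
    have "\<exists>x\<in>{0..1}. \<exists>y\<in>{0..1}. g x \<noteq> g y"
    proof (rule ccontr)
      assume "\<not> ?thesis"
      then have "\<forall>z\<in>circle. \<forall>w\<in>circle. f z = f w" using onto g by (metis diff_add_cancel)
      then show False using nonconst unfolding constant_on_def using a by blast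
    qed
    then obtain x y where "x \<in> {0..1}" "y \<in> {0..1}" "g x < g y" by (metis linorder_neqE_linordered_idom)
    then show ?thesis unfolding D by (rule tree_box_dim_ge_1[OF gcont])
  qed
  have above: "osc_bound circle f q" if "D < ereal q" for q
  proof -
    have "0 \<le> q" using D1 that by (metis ereal_less_eq(3) less_imp_le one_ereal_def order_trans zero_le_one)
    then show ?thesis
      using osc_bound_of_tree_box_dim_less[OF gcont] that bound_g unfolding D by blast
  qed
  have below: "\<not> osc_bound circle f q" if "0 \<le> q" "ereal q < D" for q
    using tree_box_dim_le[OF gcont] that bound_g unfolding D by (meson not_le)
  have index: "variation_index g = D"
  proof (rule variation_index_eq[OF _ _ D1])
    show "osc_bound {0..1} g q" if "D < ereal q" for q
    proof -
      have "0 \<le> q" using D1 that by (metis ereal_less_eq(3) less_imp_le one_ereal_def order_trans zero_le_one)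
      then show ?thesis using above[OF that] bound_g by blast
    qed
  qed (use below bound_g in auto)

  have upper: "graph_dim (f \<circ> \<tau>) \<le> 2 - 1 / D" if tau: "\<tau> \<in> circle_homeos" for \<tau>
  proof -
    obtain \<sigma> where hom: "homeomorphism circle circle \<tau> \<sigma>" using tau unfolding circle_homeos_def by blast
    define h where "h x = f (\<tau> (circle_pt x))" for x
    have "continuous_on {0..1} (\<lambda>x. \<tau> (circle_pt x))"
      using hom circle_pt_in_circle unfolding homeomorphism_def
      by (intro continuous_on_compose2[OF _ continuous_on_circle_pt]) auto
    then have hcont: "continuous_on {0..1} h"
      unfolding h_def using hom circle_pt_in_circle unfolding homeomorphism_def
      by (intro continuous_on_compose2[OF cont]) auto
    have gd: "graph_dim (f \<circ> \<tau>) = upper_box_dim (graph_on h) dist"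
      by (rule graph_dim_comp) (simp add: h_def)
    have bound_h: "osc_bound {0..1} h q \<longleftrightarrow> osc_bound circle f q" if "0 \<le> q" for q
      by (rule osc_bound_circle_iff[OF hom cont _ that, of _ 0]) (simp add: h_def)
    have two: "graph_dim (f \<circ> \<tau>) \<le> 2" using graph_box_dim_le_2[OF hcont] gd by simp
    show ?thesis
    proof (cases D)
      case PInf
      then show ?thesis using two by (simp add: divide_ereal_def)
    next
      case MInf
      then show ?thesis using D1 by simp
    next
      case (real d)
      then have d: "1 \<le> d" using D1 by simp
      have p: "graph_dim (f \<circ> \<tau>) \<le> ereal (2 - 1 / p)" if "d < p" for p
      proof -
        define q where "q = (d + p) / 2"
        have q: "d < q" "q < p" "0 < q" "1 \<le> p" using that d by (auto simp: q_def)
        then have "osc_bound {0..1} h q" using above[of q] bound_h[of q] real by simp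
        then show ?thesis unfolding gd by (rule graph_box_dim_le_of_osc_bound[OF hcont _ q(3,2,4)])
      qed
      have "graph_dim (f \<circ> \<tau>) \<le> ereal (2 - 1 / d)"
      proof (rule ccontr)
        assume "\<not> ?thesis"
        then obtain z where z: "ereal (2 - 1 / d) < ereal z" "ereal z < graph_dim (f \<circ> \<tau>)"
          by (meson ereal_dense2 not_le)
        have "ereal z < 2" using z(2) two by (rule less_le_trans)
        then have z2: "z < 2" by simp
        \<comment> \<open>The number \<open>p = 1 / (2 - z)\<close> is the one for which \<open>2 - 1 / p = z\<close>.\<close>
        have "d < 1 / (2 - z)" using z(1) z2 d by (simp add: field_simps)
        from p[OF this] z(2) show False by simp
      qed
      also have "ereal (2 - 1 / d) = 2 - 1 / D" using real d ereal_minus(1)[of 2 "1 / d"] by (simp add: one_ereal_def)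
      finally show ?thesis .
    qed
  qed

  \<comment> \<open>Exponents below \<open>D\<close> that tend to \<open>D\<close>; for \<open>D = \<infinity>\<close> their reciprocals tend to \<open>s = 0\<close>.\<close>
  obtain q s where q: "\<And>j::nat. 1/2 \<le> q j" "\<And>j. ereal (q j) < D" "(\<lambda>j. 1 / q j) \<longlonglongrightarrow> s"
    and s: "ereal (2 - s) = 2 - 1 / D"
  proof (cases D)
    case PInf
    show ?thesis
    proof (rule that[of "\<lambda>j. real (j + 1)" 0])
      show "(\<lambda>j. 1 / real (j + 1)) \<longlonglongrightarrow> 0" by (rule LIMSEQ_ignore_initial_segment[OF lim_1_over_n])
    qed (use PInf in \<open>auto simp: divide_ereal_def\<close>)
  next
    case MInf
    then show ?thesis using D1 by simp
  next
    case (real d)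
    then have d: "1 \<le> d" using D1 by simp
    show ?thesis
    proof (rule that[of "\<lambda>j. d - 1 / real (j + 2)" "1 / d"])
      have "1 / real (j + 2) \<le> 1 / 2" for j :: nat by (simp add: field_simps)
      then show "1 / 2 \<le> d - 1 / real (j + 2)" for j using d by (smt (verit) field_sum_of_halves)
      have "(\<lambda>j. d - 1 / real (j + 2)) \<longlonglongrightarrow> d - 0"
        by (intro tendsto_intros LIMSEQ_ignore_initial_segment[OF lim_1_over_n])
      then show "(\<lambda>j. 1 / (d - 1 / real (j + 2))) \<longlonglongrightarrow> 1 / d"
        using d by (intro tendsto_divide tendsto_const) auto
      show "ereal (2 - 1 / d) = 2 - 1 / D" using real d ereal_minus(1)[of 2 "1 / d"] by (simp add: one_ereal_def)
    qed (use real in auto)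
  qed
  define h where "h x = f (circle_pt x)" for x
  have id: "homeomorphism circle circle (\<lambda>z. z) (\<lambda>z. z)" by (rule homeomorphism_ident)
  have hcont: "continuous_on {0..1} h"
    unfolding h_def using circle_pt_in_circle
    by (intro continuous_on_compose2[OF cont continuous_on_circle_pt]) auto
  have "\<not> osc_bound {0..1} h (q j)" for j
  proof -
    have "0 \<le> q j" using q(1)[of j] by linarith
    then show ?thesis
      using below[OF _ q(2)] osc_bound_circle_iff[OF id cont, of h 0 "q j"] by (simp add: h_def)
  qed
  then obtain F G where FG: "homeomorphism {0..1} {0..1} F G" "F 0 = 0" "F 1 = 1"
    and dim: "ereal (2 - s) \<le> upper_box_dim (graph_on (h \<circ> G)) dist"
    using time_change_graph_large[OF hcont q(1) _ q(3)] by blast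
  obtain \<tau>' where tau': "\<tau>' \<in> circle_homeos" "\<And>x. x \<in> {0..1} \<Longrightarrow> \<tau>' (circle_pt x) = circle_pt (G x)"
    using circle_homeo_of_interval_homeo[OF FG] by blast
  have "graph_dim (f \<circ> \<tau>') = upper_box_dim (graph_on (h \<circ> G)) dist"
    by (rule graph_dim_comp) (simp add: h_def tau'(2))
  then have eq: "graph_dim (f \<circ> \<tau>') = 2 - 1 / D"
    using dim s upper[OF tau'(1)] by (simp add: antisym)

  have invert: "1 / (2 - (2 - 1 / D)) = D"
  proof (cases D)
    case (real d)
    then have "1 \<le> d" using D1 by simp
    then show ?thesis using real ereal_minus(1)[of 2 "1 / d"] ereal_minus(1)[of 2 "2 - 1 / d"] by (simp add: one_ereal_def)
  qed (use D1 in \<open>auto simp: divide_ereal_def\<close>)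
  have le: "1 / (2 - graph_dim (f \<circ> \<tau>)) \<le> D" if "\<tau> \<in> circle_homeos" for \<tau>
  proof -
    have "2 - (2 - 1 / D) \<le> 2 - graph_dim (f \<circ> \<tau>)" using upper[OF that] by (intro ereal_minus_mono) auto
    moreover have "0 \<le> 2 - (2 - 1 / D)"
    proof (cases D)
      case (real d)
      then have "1 \<le> d" using D1 by simp
      then show ?thesis
        using real ereal_minus(1)[of 2 "1 / d"] ereal_minus(1)[of 2 "2 - 1 / d"] by (simp add: one_ereal_def)
    qed (use D1 in \<open>auto simp: divide_ereal_def\<close>)
    ultimately have "1 / (2 - graph_dim (f \<circ> \<tau>)) \<le> 1 / (2 - (2 - 1 / D))"
      unfolding divide_ereal_def by (intro ereal_mult_left_mono ereal_inverse_antimono) auto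
    then show ?thesis using invert by simp
  qed
  show ?thesis
    unfolding is_maximum_def D_def[symmetric] g_def[symmetric] index
  proof (intro conjI bexI[OF _ tau'(1)] ballI)
    show "graph_dim (f \<circ> \<tau>') = 2 - 1 / D" by (rule eq)
    show "D \<in> (\<lambda>\<kappa>. 1 / (2 - graph_dim (f \<circ> \<kappa>))) ` circle_homeos"
      using tau'(1) by (rule image_eqI[rotated]) (simp only: eq invert)
    show "1 / (2 - graph_dim (f \<circ> \<tau>)) \<le> D" if "\<tau> \<in> circle_homeos" for \<tau>
      using that by (rule le)
    show "r \<le> D" if "r \<in> (\<lambda>\<kappa>. 1 / (2 - graph_dim (f \<circ> \<kappa>))) ` circle_homeos" for r
      using that le by blast
  qed (rule refl)
qed

end
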